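(* Let $f\in C(\mathbb R^{1+n},\mathbb R^n)$, suppose every solution of the system $\dot x=f(t,x)$ has the uniqueness property, and let conditions (d)–(g) of the context hold. Then there exists a solution $x_*(t)$, $t\in\mathbb R$, of this system such that $$\langle B(t)x_*(t),x_*(t)\rangle\le F^{-1}\!\left(\frac{v_0}{2}\Big[\sup_{s\ge t}\lambda^+(s)-\inf_{s\le t}\lambda_-(s)\Big]\right)\le v_*\quad\forall t\in\mathbb R,$$ where $$F(v):=\int_{v_0}^v\frac{2\Gamma(u)+\xi u}{2\Delta(u)+\varsigma u}\,du\qquad(v\ge v_0)$$ and $v_*$ is the root of the equation $$F(v)=\frac{v_0}{2}\Big[\sup_{t\in\mathbb R}\lambda^+(t)-\inf_{t\in\mathbb R}\lambda_-(t)\Big].$$ If in addition $2\gamma(t)+\mu_-(t)>0$ for all $t\in\mathbb R$, $$\langle S(t)(f(t,x+y)-f(t,x)),y\rangle\ge\gamma(t)\langle B(t)y,y\rangle\quad\forall(t,x,y)\in\mathbb R^{1+2n},$$ and $$\int_0^{\pm\infty}\frac{2\gamma(s)+\mu_-(s)}{\max\{\lambda^+(s),|\lambda_-(s)|\}}\,ds=\pm\infty,\qquad \liminf_{t\to\pm\infty}\frac{\ln\max\{\lambda^+(t),|\lambda_-(t)|\}}{\left|\int_0^t\frac{2\gamma(s)+\mu_-(s)}{\max\{\lambda^+(s),|\lambda_-(s)|\}}\,ds\right|}<1,$$ then $x_*(t)$ is the unique solution of the system satisfying $\sup_{t\in\mathbb R}\langle B(t)x_*(t),x_*(t)\rangl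e<\infty$.
   Context: $\langle\cdot,\cdot\rangle$ is a scalar product on $\mathbb R^n$. $S\in C^1(\mathbb R,\mathrm{Aut}(\mathbb R^n))$ and $B\in C^1(\mathbb R,\mathrm{Aut}(\mathbb R^n))$ take values in symmetric operators, and the quadratic form $\langle S(t)x,x\rangle$ is nondegenerate and indefinite. A characteristic value of a pencil $S-\lambda B$ is a $\lambda$ with $\det(S-\lambda B)=0$. (d): for every $t\in\mathbb R$ the operator $B(t)$ is positive-definite, and there are projectors $P_+(t),P_-(t)$ onto invariant subspaces $\mathbb L_+(t),\mathbb L_-(t)$ of $S(t)$ (with $\mathbb R^n=\mathbb L_+(t)\oplus\mathbb L_-(t)$) such that the restriction of $S(t)$ to $\mathbb L_+(t)$ (to $\mathbb L_-(t)$) is positive-definite (negative-definite). (e): there exist $\gamma\in C(\mathbb R,(0,\infty))$, $\Gamma\in C((0,\infty),\mathbb R)$, $\Delta\in C((0,\infty),(0,\infty))$ such that for all $t\in\mathbb R$ and $v>0$ $$\min_{\langle B(t)x,x\rangle=v}\langle S(t)f(t,x),x\rangle\ge\gamma(t)\Gamma(v),\qquad \max_{\langle B(t)x,x\rangle=v}|\langle B(t)f(t,x),x\rangle|\le\gamma(t)\Delta(v),$$ and $\int_{-\infty}^0\gamma(t)\,dt=\int_0^\infty\gamma(t)\,dt=\infty$. (f): $\sup_t\lambda^+(t)<\infty$, $\inf_t\lambda_-(t)>-\infty$, $\limsup_{t\to-\infty}\lambda_-^+(t)>0$, $\inf_t\frac{\mu_-(t)}{\gamma(t)}=:\xi>-\infty$,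 $\sup_t\frac{M(t)}{\gamma(t)}=:\varsigma<\infty$, where $\lambda^+(t)$ and $\lambda_-(t)$ are the maximal and minimal characteristic values of the pencil $S(t)-\lambda B(t)$; $\lambda_-^+(t)$ is the minimal characteristic value of the pencil $P_+(t)[S(t)-\lambda B(t)]|_{\mathbb L_+(t)}$; $M(t)$ is the maximum of the moduli of the maximal and minimal characteristic values of the pencil $\dot B(t)-\mu B(t)$; $\mu_-(t)$ is the minimal characteristic value of the pencil $\dot S(t)-\mu B(t)$. (g): there exists $v_0>0$ such that $2\Gamma(v_0)+\xi v_0>0$, $\frac{\Gamma(v)-\Gamma(v_0)}{v-v_0}\ge-\frac\xi2$ for all $v>v_0$, and $\int_{v_0}^\infty\frac{2\Gamma(v)+\xi v}{2\Delta(v)+\varsigma v}\,dv=\infty$. $F^{-1}$ is the inverse of $F:[v_0,\infty)\to[0,\infty)$. Conditions with $\pm$ are required for both signs. *)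

theory Defs
  imports "HOL-Analysis.Analysis" "HOL-Combinatorics.Permutations"
begin

definition is_scalar_product :: "(real^'n \<Rightarrow> real^'n \<Rightarrow> real) \<Rightarrow> bool" where
  "is_scalar_product sp \<longleftrightarrow>
     bilinear sp \<and> (\<forall>x y. sp x y = sp y x) \<and> (\<forall>x. x \<noteq> 0 \<longrightarrow> 0 < sp x x)"

definition symmetric_op :: "(real^'n \<Rightarrow> real^'n \<Rightarrow> real) \<Rightarrow> real^'n^'n \<Rightarrow> bool" where
  "symmetric_op sp A \<longleftrightarrow> (\<forall>x y. sp (A *v x) y = sp x (A *v y))"

definition pos_def_on ::
  "(real^'n \<Rightarrow> real^'n \<Rightarrow> real) \<Rightarrow> (real^'n) set \<Rightarrow> real^'n^'n \<Rightarrow> bool" where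
  "pos_def_on sp L A \<longleftrightarrow> (\<forall>x\<in>L. x \<noteq> 0 \<longrightarrow> 0 < sp (A *v x) x)"

definition neg_def_on ::
  "(real^'n \<Rightarrow> real^'n \<Rightarrow> real) \<Rightarrow> (real^'n) set \<Rightarrow> real^'n^'n \<Rightarrow> bool" where
  "neg_def_on sp L A \<longleftrightarrow> (\<forall>x\<in>L. x \<noteq> 0 \<longrightarrow> sp (A *v x) x < 0)"

definition nondegenerate_form ::
  "(real^'n \<Rightarrow> real^'n \<Rightarrow> real) \<Rightarrow> real^'n^'n \<Rightarrow> bool" where
  "nondegenerate_form sp A \<longleftrightarrow> (\<forall>x. (\<forall>y. sp (A *v x) y = 0) \<longrightarrow> x = 0)"

definition indefinite_form ::
  "(real^'n \<Rightarrow> real^'n \<Rightarrow> real) \<Rightarrow> real^'n^'n \<Rightarrow> bool" where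
  "indefinite_form sp A \<longleftrightarrow> (\<exists>x. 0 < sp (A *v x) x) \<and> (\<exists>x. sp (A *v x) x < 0)"

text \<open>\<open>P\<close> and \<open>Q\<close> are the projectors onto the two summands of the direct sum of \<open>L\<close> and \<open>M\<close>,
  each along the other summand.\<close>

definition direct_sum_projectors ::
  "real^'n^'n \<Rightarrow> real^'n^'n \<Rightarrow> (real^'n) set \<Rightarrow> (real^'n) set \<Rightarrow> bool" where
  "direct_sum_projectors P Q L M \<longleftrightarrow>
     subspace L \<and> subspace M \<and> L \<inter> M = {0} \<and> (\<forall>x. \<exists>y\<in>L. \<exists>z\<in>M. x = y + z) \<and>
     (\<forall>x\<in>L. P *v x = x \<and> Q *v x = 0) \<and> (\<forall>x\<in>M. P *v x = 0 \<and> Q *v x = x)"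

definition invariant_subspace :: "real^'n^'n \<Rightarrow> (real^'n) set \<Rightarrow> bool" where
  "invariant_subspace A L \<longleftrightarrow> subspace L \<and> (\<forall>x\<in>L. A *v x \<in> L)"

text \<open>The determinant of a linear endomorphism \<open>A\<close> of a finite-dimensional subspace \<open>L\<close>: the Leibniz
  formula for the matrix of \<open>A\<close> in a basis of \<open>L\<close>, with rows and columns indexed by the basis vectors
  themselves.  The value does not depend on the basis chosen.\<close>

definition det_on :: "'a::real_vector set \<Rightarrow> ('a \<Rightarrow> 'a) \<Rightarrow> real" where
  "det_on L A =
     (let b = (SOME b. independent b \<and> span b = L)
      in \<Sum>p | p permutes b. of_int (sign p) * (\<Prod>v\<in>b. representation b (A v) (p v)))"

definition char_values :: "real^'n^'n \<Rightarrow> real^'n^'n \<Rightarrow> real set" where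
  "char_values A B = {l. det (A - l *\<^sub>R B) = 0}"

text \<open>For the pencil compressed to \<open>L\<close>, where \<open>P\<close> is a projector onto \<open>L\<close>.\<close>

definition char_values_on ::
  "real^'n^'n \<Rightarrow> (real^'n) set \<Rightarrow> real^'n^'n \<Rightarrow> real^'n^'n \<Rightarrow> real set" where
  "char_values_on P L A B = {l. det_on L (\<lambda>x. P *v ((A - l *\<^sub>R B) *v x)) = 0}"

text \<open>When \<open>A\<close> is symmetric and \<open>B\<close> is symmetric positive-definite, the set of characteristic values
  is finite and nonempty, so \<open>Max\<close> and \<open>Min\<close> are meaningful.\<close>

definition max_char :: "real^'n^'n \<Rightarrow> real^'n^'n \<Rightarrow> real" where
  "max_char A B = Max (char_values A B)"

definition min_char :: "real^'n^'n \<Rightarrow> real^'n^'n \<Rightarrow> real" where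
  "min_char A B = Min (char_values A B)"

definition ode_solution_on :: "(real \<Rightarrow> real^'n \<Rightarrow> real^'n) \<Rightarrow> real set \<Rightarrow> (real \<Rightarrow> real^'n) \<Rightarrow> bool" where
  "ode_solution_on f I x \<longleftrightarrow> (\<forall>t\<in>I. (x has_vector_derivative f t (x t)) (at t within I))"

definition ode_uniqueness :: "(real \<Rightarrow> real^'n \<Rightarrow> real^'n) \<Rightarrow> bool" where
  "ode_uniqueness f \<longleftrightarrow>
     (\<forall>I x y. is_interval I \<and> ode_solution_on f I x \<and> ode_solution_on f I y \<and>
        (\<exists>t\<in>I. x t = y t) \<longrightarrow> (\<forall>t\<in>I. x t = y t))"

text \<open>The oriented integral from \<open>a\<close> to \<open>b\<close>, which changes sign when the endpoints are swapped.\<close>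

abbreviation oint :: "real \<Rightarrow> real \<Rightarrow> (real \<Rightarrow> real) \<Rightarrow> real" where
  "oint a b g \<equiv> interval_lebesgue_integral lborel (ereal a) (ereal b) g"

end

theory Submission
  imports Defs "HOL-Complex_Analysis.Great_Picard"
begin

text \<open>Write \<open>U = \<langle>S x, x\<rangle>\<close> and \<open>V = \<langle>B x, x\<rangle>\<close>. Along a solution, as long as \<open>V \<ge> v\<^sub>0\<close>, the form
  \<open>U\<close> increases at least as fast as \<open>F(V)\<close> varies. Hence an excursion of a bounded solution above
  the level \<open>V = v\<^sub>0\<close> has finite length, and comparing \<open>U\<close> at its two ends bounds \<open>F(V)\<close> by
  \<open>v\<^sub>0 / 2\<close> times the oscillation of the characteristic values.

  A bounded solution on \<open>[a, b]\<close> comes from a Wazewski-type argument: start in a large ball of the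
  positive subspace of \<open>S(a)\<close>. Boundary points keep \<open>U > 0\<close>, so if all points of the ball had \<open>U > 0\<close>
  at time \<open>b\<close>, the sphere would be contractible in the cone \<open>U > 0\<close>; a congruence \<open>D(t)\<close> carrying
  \<open>S(t)\<close> to \<open>S(a)\<close> brings all of this into one fixed subspace, where it contradicts Brouwer's
  theorem. A solution ending with \<open>U \<le> 0\<close> satisfies a bound on \<open>V\<close> that does not depend on \<open>[a, b]\<close>.
  The argument is run for Euler polygons, which depend continuously on the initial point, and the
  step is then sent to zero; no flow is needed.

  For uniqueness, \<open>U\<close> of the difference of two bounded solutions grows exponentially in one time
  direction, which the assumption on the limit inferior excludes.\<close>

section \<open>Euler polygons and compactness of approximate solutions\<close>

text \<open>Call \<open>N\<close> and \<open>E\<close> the rates with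
  \<open>U' \<ge> \<gamma> N(V)\<close> and \<open>\<bar>V'\<bar> \<le> \<gamma> E(V)\<close> for
  \<open>V \<ge> v\<^sub>0\<close>. Taking \<open>F' = N / E\<close> cancels the factor
  \<open>\<gamma>\<close>, so that one time-independent function compares \<open>U\<close> with
  \<open>V\<close> whether \<open>V\<close> rises or falls. The radii \<open>C0 < C1\<close> come
  from the same comparison. A fall of \<open>V\<close> from \<open>C0\<close> to
  \<open>v\<^sub>0\<close> lifts \<open>U\<close> by at least \<open>F C0\<close>; after a positive
  start this passes \<open>\<Lambda> v\<^sub>0\<close>, an upper bound of \<open>U\<close> on the
  level \<open>V = v\<^sub>0\<close>. A climb from \<open>C0\<close> to \<open>C1\<close> lifts
  \<open>U\<close> from at least \<open>l C0\<close> beyond \<open>\<Lambda> v\<^sub>0\<close>, and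
  from there \<open>U\<close> cannot decrease. Neither radius refers to the time interval. Two
  obstacles shape the existence part. The field is merely continuous with no growth bound in
  \<open>x\<close>, so solutions might blow up; hence it is replaced far out by a linear field that
  does not disturb \<open>U\<close>. And the cone \<open>U > 0\<close> moves with time; hence the
  congruence, which makes it stand still.\<close>

text \<open>Over each subinterval, the average slope of \<open>z\<close> is no farther from any vector \<open>w\<close> than
  the field along \<open>z\<close>, read off with time lag at most \<open>h\<close>. Euler polygons of step \<open>h\<close> and,
  for \<open>h = 0\<close>, exact solutions have this property.\<close>

definition approx_sol ::
  "(real \<Rightarrow> 'a \<Rightarrow> 'a) \<Rightarrow> real \<Rightarrow> real \<Rightarrow> real \<Rightarrow> (real \<Rightarrow> 'a::euclidean_space) \<Rightarrow> bool" where
  "approx_sol g a b h z \<longleftrightarrow>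
     (\<forall>t t' w e. a \<le> t' \<and> t' \<le> t \<and> t \<le> b \<and>
        (\<forall>\<tau>\<in>{a..b}. t' - h \<le> \<tau> \<and> \<tau> \<le> t \<longrightarrow> norm (g \<tau> (z \<tau>) - w) \<le> e) \<longrightarrow>
        norm (z t - z t' - (t - t') *\<^sub>R w) \<le> e * (t - t'))"

lemma approx_solD:
  assumes "approx_sol g a b h z" "a \<le> t'" "t' \<le> t" "t \<le> b"
    "\<And>\<tau>. \<tau> \<in> {a..b} \<Longrightarrow> t' - h \<le> \<tau> \<Longrightarrow> \<tau> \<le> t \<Longrightarrow> norm (g \<tau> (z \<tau>) - w) \<le> e"
  shows "norm (z t - z t' - (t - t') *\<^sub>R w) \<le> e * (t - t')"
  using assms unfolding approx_sol_def by blast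

text \<open>Mean value inequality for \<open>z \<tau> - \<tau> *\<^sub>R w\<close>, whose derivative
  is the field along \<open>z\<close> minus \<open>w\<close>.\<close>

lemma approx_sol_exact:
  assumes "\<And>t. t \<in> {a..b} \<Longrightarrow> (z has_vector_derivative g t (z t)) (at t within {a..b})"
  shows "approx_sol g a b 0 z"
  unfolding approx_sol_def
proof (intro allI impI, elim conjE)
  fix t t' w e
  assume t: "a \<le> t'" "t' \<le> t" "t \<le> b"
    and bd: "\<forall>\<tau>\<in>{a..b}. t' - 0 \<le> \<tau> \<and> \<tau> \<le> t \<longrightarrow> norm (g \<tau> (z \<tau>) - w) \<le> e"
  have "norm ((\<lambda>\<tau>. z \<tau> - \<tau> *\<^sub>R w) t - (\<lambda>\<tau>. z \<tau> - \<tau> *\<^sub>R w) t') \<le> e * norm (t - t')"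
  proof (rule differentiable_bound[where S="{t'..t}" and f'="\<lambda>\<tau> s. s *\<^sub>R (g \<tau> (z \<tau>) - w)"])
    fix \<tau> assume \<tau>: "\<tau> \<in> {t'..t}"
    have "(z has_vector_derivative g \<tau> (z \<tau>)) (at \<tau> within {t'..t})"
      using assms[of \<tau>] \<tau> t by (auto intro: has_vector_derivative_within_subset)
    then have "((\<lambda>\<tau>. z \<tau> - \<tau> *\<^sub>R w) has_vector_derivative (g \<tau> (z \<tau>) - 1 *\<^sub>R w)) (at \<tau> within {t'..t})"
      by (auto intro!: derivative_eq_intros)
    then show "((\<lambda>\<tau>. z \<tau> - \<tau> *\<^sub>R w) has_derivative (\<lambda>s. s *\<^sub>R (g \<tau> (z \<tau>) - w))) (at \<tau> within {t'..t})"
      by (simp add: has_vector_derivative_def)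
    have "norm (g \<tau> (z \<tau>) - w) \<le> e" using bd \<tau> t by auto
    then show "onorm (\<lambda>s. s *\<^sub>R (g \<tau> (z \<tau>) - w)) \<le> e"
      by (intro onorm_le) (simp add: mult.commute[of e] mult_left_mono)
  qed (use t in auto)
  then show "norm (z t - z t' - (t - t') *\<^sub>R w) \<le> e * (t - t')"
    using t by (simp add: algebra_simps)
qed

text \<open>The slope inequality does all the work. With \<open>w = 0\<close> it gives a common
  Lipschitz constant, hence a uniformly convergent subsequence by Arzela-Ascoli; with
  \<open>w = g t0 (y t0)\<close> it survives pointwise limits and becomes the difference quotient of
  the limit at \<open>t0\<close>. Derivatives of the \<open>z k\<close>, which polygons may lack at
  nodes, never enter.\<close>

lemma approx_sol_limit:
  fixes z :: "nat \<Rightarrow> real \<Rightarrow> 'a::euclidean_space"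
  assumes "a < b"
    and g: "continuous_on UNIV (\<lambda>(t, x). g t x)"
    and sol: "\<And>k. approx_sol g a b (h k) (z k)" and h: "h \<longlonglongrightarrow> 0" 
    and bd: "\<And>k t. t \<in> {a..b} \<Longrightarrow> norm (z k t) \<le> R"
  obtains y r where "strict_mono (r :: nat \<Rightarrow> nat)" "continuous_on {a..b} y"
    "\<And>e. 0 < e \<Longrightarrow> \<exists>N. \<forall>n t. n \<ge> N \<and> t \<in> {a..b} \<longrightarrow> norm (z (r n) t - y t) < e"
    "\<And>t. t \<in> {a..b} \<Longrightarrow> (y has_vector_derivative g t (y t)) (at t within {a..b})"
proof -
  have "compact ((\<lambda>(t, x). g t x) ` ({a..b} \<times> cball 0 R))"
    by (intro compact_continuous_image compact_Times) (auto intro: continuous_on_subset[OF g])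
  then obtain K where K: "\<And>t x. t \<in> {a..b} \<Longrightarrow> norm x \<le> R \<Longrightarrow> norm (g t x) \<le> K" "K > 0"
    using bounded_pos[THEN iffD1, OF compact_imp_bounded] by fastforce
  have lip': "norm (z k t - z k t') \<le> K * (t - t')" if "a \<le> t'" "t' \<le> t" "t \<le> b" for k t t'
    using approx_solD[OF sol, where t=t and t'=t' and w=0 and e=K] that K(1) bd by simp
  have lip: "norm (z k t - z k t') \<le> K * \<bar>t - t'\<bar>" if "t' \<in> {a..b}" "t \<in> {a..b}" for k t t'
    using lip'[of t' t k] lip'[of t t' k] that by (cases "t' \<le> t") (auto simp: norm_minus_commute)
  have eq: "\<exists>d>0. \<forall>n s. s \<in> {a..b} \<and> norm (t - s) < d \<longrightarrow> norm (z n t - z n s) < e" 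
    if "t \<in> {a..b}" "0 < e" for t e
  proof (intro exI[of _ "e / K"] conjI allI impI)
    fix n s assume s: "s \<in> {a..b} \<and> norm (t - s) < e / K"
    then have "norm (z n t - z n s) \<le> K * \<bar>t - s\<bar>" using lip that by auto
    also have "\<dots> < e" using s \<open>K > 0\<close> by (simp add: field_simps)
    finally show "norm (z n t - z n s) < e" .
  qed (use that K in auto)
  obtain y r where y: "continuous_on {a..b} y" and r: "strict_mono (r :: nat \<Rightarrow> nat)"
    and lim: "\<And>e. 0 < e \<Longrightarrow> \<exists>N. \<forall>n t. n \<ge> N \<and> t \<in> {a..b} \<longrightarrow> norm (z (r n) t - y t) < e"
    using Arzela_Ascoli[of "{a..b}" z R, OF _ bd eq] by (metis compact_Icc)
  have pw: "(\<lambda>n. z (r n) t) \<longlonglongrightarrow> y t" if "t \<in> {a..b}" for t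
    unfolding lim_sequentially dist_norm using lim that by meson
  have main: "\<exists>d>0. \<forall>t t'. a \<le> t' \<and> t' \<le> t \<and> t \<le> b \<and> \<bar>t - t0\<bar> < d \<and> \<bar>t' - t0\<bar> < d \<longrightarrow>
     norm (y t - y t' - (t - t') *\<^sub>R g t0 (y t0)) \<le> e * (t - t')" 
    if t0: "t0 \<in> {a..b}" and "0 < e" for t0 e
  proof -
    have "isCont (\<lambda>(t, x). g t x) (t0, y t0)"
      using g by (simp add: continuous_on_eq_continuous_at)
    then obtain d where d: "d > 0" "\<And>t x. dist (t, x) (t0, y t0) < d \<Longrightarrow> norm (g t x - g t0 (y t0)) < e"
      unfolding continuous_at_eps_delta using \<open>0 < e\<close> by (force simp: dist_norm)
    obtain d1 where d1: "d1 > 0" "\<And>t. t \<in> {a..b} \<Longrightarrow> \<bar>t - t0\<bar> < d1 \<Longrightarrow> norm (y t - y t0) < d / 4"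
      using y t0 \<open>d > 0\<close> unfolding continuous_on_iff dist_norm 
      by (metis divide_pos_pos real_norm_def zero_less_numeral)
    \<comment> \<open>The field is read up to \<open>h (r n) < d2\<close> earlier, hence within
      \<open>2 * d2\<close> of \<open>t0\<close>; this choice makes \<open>2 * d2\<close> at most
      \<open>d1\<close> and at most \<open>d / 2\<close>.\<close>
    define d2 where "d2 = min (d / 2) d1 / 2"
    have d2: "d2 > 0" using d d1 by (auto simp: d2_def)
    show ?thesis
    proof (intro exI[of _ d2] conjI allI impI)
      fix t t' assume t: "a \<le> t' \<and> t' \<le> t \<and> t \<le> b \<and> \<bar>t - t0\<bar> < d2 \<and> \<bar>t' - t0\<bar> < d2"
      have "\<forall>\<^sub>F n in sequentially. h (r n) < d2"
        using order_tendstoD(2)[OF LIMSEQ_subseq_LIMSEQ[OF h r], of d2] d2 by (simp add: o_def)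
      moreover have "\<forall>\<^sub>F n in sequentially. \<forall>t\<in>{a..b}. norm (z (r n) t - y t) < d / 4"
      proof -
        obtain N where "\<forall>n t. n \<ge> N \<and> t \<in> {a..b} \<longrightarrow> norm (z (r n) t - y t) < d / 4"
          using lim[of "d / 4"] d(1) by auto
        then show ?thesis by (intro eventually_sequentiallyI[of N]) blast
      qed
      ultimately have "\<forall>\<^sub>F n in sequentially. norm (z (r n) t - z (r n) t' - (t - t') *\<^sub>R g t0 (y t0)) \<le> e * (t - t')"
      proof eventually_elim
        case (elim n)
        show ?case
        proof (rule approx_solD[OF sol])
          fix \<tau> assume \<tau>: "\<tau> \<in> {a..b}" "t' - h (r n) \<le> \<tau>" "\<tau> \<le> t"
          have *: "\<bar>\<tau> - t0\<bar> < 2 * d2" using \<tau> t elim(1) by linarith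
          then have "norm (y \<tau> - y t0) < d / 4" using d1(2)[OF \<tau>(1)] by (auto simp: d2_def)
          moreover have "norm (z (r n) \<tau> - y \<tau>) < d / 4" using elim(2) \<tau>(1) by auto
          ultimately have "norm (z (r n) \<tau> - y t0) < d / 2"
            using norm_triangle_ineq[of "z (r n) \<tau> - y \<tau>" "y \<tau> - y t0"] by simp
          moreover have "dist (\<tau>, z (r n) \<tau>) (t0, y t0) \<le> \<bar>\<tau> - t0\<bar> + norm (z (r n) \<tau> - y t0)"
            using norm_Pair_le[of "\<tau> - t0" "z (r n) \<tau> - y t0"] by (simp add: dist_norm)
          ultimately have "dist (\<tau>, z (r n) \<tau>) (t0, y t0) < d" using * by (auto simp: d2_def)
          then show "norm (g \<tau> (z (r n) \<tau>) - g t0 (y t0)) \<le> e" using d by fastforce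
        qed (use t in auto)
      qed
      moreover have "(\<lambda>n. norm (z (r n) t - z (r n) t' - (t - t') *\<^sub>R g t0 (y t0)))
         \<longlonglongrightarrow> norm (y t - y t' - (t - t') *\<^sub>R g t0 (y t0))"
        using t by (intro tendsto_intros pw) auto
      ultimately show "norm (y t - y t' - (t - t') *\<^sub>R g t0 (y t0)) \<le> e * (t - t')"
        by (intro tendsto_upperbound) auto
    qed (use d2 in auto)
  qed
  have "(y has_vector_derivative g t0 (y t0)) (at t0 within {a..b})" if t0: "t0 \<in> {a..b}" for t0
    unfolding has_vector_derivative_def has_derivative_within_alt
  proof (intro conjI allI impI)
    fix e :: real assume "0 < e"
    obtain d where d: "d > 0" "\<And>t t'. a \<le> t' \<Longrightarrow> t' \<le> t \<Longrightarrow> t \<le> b \<Longrightarrow> \<bar>t - t0\<bar> < d \<Longrightarrow> \<bar>t' - t0\<bar> < d \<Longrightarrow>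
     norm (y t - y t' - (t - t') *\<^sub>R g t0 (y t0)) \<le> e * (t - t')"
      using main[OF t0 \<open>0 < e\<close>] by blast
    show "\<exists>d>0. \<forall>t\<in>{a..b}. norm (t - t0) < d \<longrightarrow> norm (y t - y t0 - (t - t0) *\<^sub>R g t0 (y t0)) \<le> e * norm (t - t0)"
    proof (intro exI[of _ d] conjI ballI impI)
      fix t assume t: "t \<in> {a..b}" "norm (t - t0) < d"
      show "norm (y t - y t0 - (t - t0) *\<^sub>R g t0 (y t0)) \<le> e * norm (t - t0)"
      proof (cases "t0 \<le> t")
        case True
        then show ?thesis using d(2)[of t0 t] t t0 d(1) by auto
      next
        case False
        have "y t - y t0 - (t - t0) *\<^sub>R g t0 (y t0) = - (y t0 - y t - (t0 - t) *\<^sub>R g t0 (y t0))"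
          by (simp add: algebra_simps)
        then have "norm (y t - y t0 - (t - t0) *\<^sub>R g t0 (y t0)) = norm (y t0 - y t - (t0 - t) *\<^sub>R g t0 (y t0))"
          by (simp only: norm_minus_cancel)
        also have "\<dots> \<le> e * (t0 - t)" using t t0 d(1) False by (intro d(2)) auto
        finally show ?thesis using False by simp
      qed
    qed (use d in auto)
  qed (auto intro: bounded_linear_scaleR_left)
  with that[OF r y lim] show ?thesis by simp
qed

section \<open>Euler polygons: approximation property, growth, convergence\<close>

primrec euler_pt :: "(real \<Rightarrow> 'a \<Rightarrow> 'a) \<Rightarrow> real \<Rightarrow> real \<Rightarrow> 'a::real_vector \<Rightarrow> nat \<Rightarrow> 'a" where
  "euler_pt g a h x 0 = x"
| "euler_pt g a h x (Suc j) = euler_pt g a h x j + h *\<^sub>R g (a + j * h) (euler_pt g a h x j)"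

text \<open>The Euler polygon, written as a sum in which the clamped times make joint continuity in
  \<open>t\<close> and \<open>x\<close> evident.\<close>

definition euler ::
  "(real \<Rightarrow> 'a \<Rightarrow> 'a) \<Rightarrow> real \<Rightarrow> real \<Rightarrow> nat \<Rightarrow> real \<Rightarrow> 'a::real_vector \<Rightarrow> 'a" where
  "euler g a h N t x =
     x + (\<Sum>j<N. max 0 (min (t - (a + j * h)) h) *\<^sub>R g (a + j * h) (euler_pt g a h x j))"

text \<open>The summands are the portions of the successive steps that have elapsed by time
  \<open>t\<close>; together they tile \<open>{a..t}\<close>.\<close>

lemma sum_clamp:
  fixes h t :: real
  assumes "0 < h" "a \<le> t" "t \<le> a + N * h"
  shows "(\<Sum>j<N. max 0 (min (t - (a + real j * h)) h)) = t - a"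
  using assms(2,3)
proof (induction N arbitrary: t)
  case (Suc N)
  show ?case
  proof (cases "t \<le> a + N * h")
    case True
    then show ?thesis using Suc by simp
  next
    case False
    have "(\<Sum>j<N. max 0 (min (t - (a + real j * h)) h)) = (\<Sum>j<N. max 0 (min (a + N * h - (a + real j * h)) h))"
    proof (rule sum.cong)
      fix j assume "j \<in> {..<N}"
      then have "real j + 1 \<le> real N" by auto
      then have "(real j + 1) * h \<le> real N * h" using \<open>0 < h\<close> by (intro mult_right_mono) auto
      then have "real j * h + h \<le> real N * h" by (simp add: distrib_right)
      then show "max 0 (min (t - (a + real j * h)) h) = max 0 (min (a + N * h - (a + real j * h)) h)"
        using False by (auto simp: min_def)
    qed simp
    also have "\<dots> = N * h" using Suc.IH[of "a + N * h"] \<open>0 < h\<close> by simp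
    finally show ?thesis using False Suc.prems by (simp add: algebra_simps)
  qed
qed simp

lemma euler_node:
  assumes "0 < h" "j \<le> N"
  shows "euler g a h N (a + j * h) x = euler_pt g a h x j"
proof -
  have c: "max 0 (min (a + real j * h - (a + real i * h)) h) = (if i < j then h else 0)" for i
  proof (cases "i < j")
    case True
    then have "real i + 1 \<le> real j" by auto
    then have "(real i + 1) * h \<le> real j * h" using \<open>0 < h\<close> by (intro mult_right_mono) auto
    then show ?thesis using True \<open>0 < h\<close> by (auto simp: distrib_right min_def)
  next
    case False
    then have "real j * h \<le> real i * h" using \<open>0 < h\<close> by (intro mult_right_mono) auto
    then show ?thesis using False by (auto simp: min_def)
  qed
  have "(\<Sum>i<N. max 0 (min (a + real j * h - (a + real i * h)) h) *\<^sub>R g (a + i * h) (euler_pt g a h x i))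
    = (\<Sum>i\<in>{..<N}. if i < j then h *\<^sub>R g (a + i * h) (euler_pt g a h x i) else 0)"
    by (intro sum.cong refl) (subst c, simp)
  also have "\<dots> = (\<Sum>i\<in>{..<j}. h *\<^sub>R g (a + i * h) (euler_pt g a h x i))"
    using \<open>j \<le> N\<close> by (subst sum.If_cases) (auto intro!: sum.cong)
  finally have "euler g a h N (a + j * h) x = x + (\<Sum>i\<in>{..<j}. h *\<^sub>R g (a + i * h) (euler_pt g a h x i))"
    by (simp add: euler_def)
  also have "\<dots> = euler_pt g a h x j"
    by (induction j) (auto simp: add.assoc[symmetric])
  finally show ?thesis .
qed

lemma euler_start: "0 < h \<Longrightarrow> euler g a h N a x = x"
  using euler_node[of h 0 N g a x] by simp

lemma continuous_on_euler:
  fixes g :: "real \<Rightarrow> 'a::euclidean_space \<Rightarrow> 'a"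
  assumes g: "continuous_on UNIV (\<lambda>(t, x). g t x)"
  shows "continuous_on UNIV (\<lambda>(t, x). euler g a h N t x)"
proof -
  have gx: "continuous_on UNIV (g t)" for t
    using continuous_on_compose2[OF g, of UNIV "\<lambda>x. (t, x)"]
      continuous_on_Pair[OF continuous_on_const continuous_on_id, of UNIV t] by simp
  have pt: "continuous_on UNIV (\<lambda>x. euler_pt g a h x j)" for j
    by (induction j) (auto intro!: continuous_intros continuous_on_compose2[OF gx])
  show ?thesis unfolding euler_def split_def
    by (intro continuous_intros continuous_on_compose2[OF gx] continuous_on_compose2[OF pt]) auto
qed

text \<open>The increment over \<open>{t'..t}\<close> is a sum of node slopes with nonnegative
  weights of total \<open>t - t'\<close>. A node with positive weight lies strictly between
  \<open>t' - h\<close> and \<open>t\<close>, which is the origin of the time lag in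
  \<open>approx_sol\<close>.\<close>

lemma euler_approx_sol:
  assumes "0 < h" "b = a + N * h"
  shows "approx_sol g a b h (\<lambda>t. euler g a h N t x)"
  unfolding approx_sol_def
proof (intro allI impI, elim conjE)
  fix t t' w e
  let ?c = "\<lambda>t j. max 0 (min (t - (a + real j * h)) h)"
  let ?g = "\<lambda>j. g (a + real j * h) (euler_pt g a h x j)"
  assume t: "a \<le> t'" "t' \<le> t" "t \<le> b"
    and bd: "\<forall>\<tau>\<in>{a..b}. t' - h \<le> \<tau> \<and> \<tau> \<le> t \<longrightarrow> norm (g \<tau> (euler g a h N \<tau> x) - w) \<le> e"
  have s: "(\<Sum>j<N. ?c t j - ?c t' j) = t - t'"
    using sum_clamp[of h a t N] sum_clamp[of h a t' N] assms t by (simp add: sum_subtractf)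
  then have w: "(t - t') *\<^sub>R w = (\<Sum>j<N. (?c t j - ?c t' j) *\<^sub>R w)"
    by (simp only: scaleR_sum_left[symmetric])
  have "norm (euler g a h N t x - euler g a h N t' x - (t - t') *\<^sub>R w) = norm (\<Sum>j<N. (?c t j - ?c t' j) *\<^sub>R (?g j - w))"
    unfolding w euler_def
    by (simp add: sum_subtractf scaleR_diff_left scaleR_diff_right)
  also have "\<dots> \<le> (\<Sum>j<N. (?c t j - ?c t' j) * e)"
  proof (rule sum_norm_le)
    fix j assume j: "j \<in> {..<N}"
    have mono: "0 \<le> ?c t j - ?c t' j" using t by (auto simp: max_def min_def)
    show "norm ((?c t j - ?c t' j) *\<^sub>R (?g j - w)) \<le> (?c t j - ?c t' j) * e"
    proof (cases "?c t j - ?c t' j = 0")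
      case False
      then have "t > a + real j * h" "t' < a + real j * h + h" using t \<open>0 < h\<close>
        by (auto simp: max_def min_def split: if_splits)
      moreover have "real j * h \<le> real N * h" using j \<open>0 < h\<close> by (intro mult_right_mono) auto
      ultimately have "norm (g (a + real j * h) (euler g a h N (a + real j * h) x) - w) \<le> e"
        using bd \<open>0 < h\<close> assms by auto
      then have "norm (?g j - w) \<le> e" using euler_node[of h j N g a x] j \<open>0 < h\<close> by simp
      then show ?thesis using mono by (simp only: norm_scaleR abs_of_nonneg mult_left_mono)
    qed simp
  qed
  also have "\<dots> = e * (t - t')" using s by (simp add: sum_distrib_right[symmetric])
  finally show "norm (euler g a h N t x - euler g a h N t' x - (t - t') *\<^sub>R w) \<le> e * (t - t')" .
qed

text \<open>Discrete Gronwall: one step multiplies \<open>1 + norm\<close> by at most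
  \<open>1 + K * h\<close>, hence by at most \<open>exp (K * h)\<close>. The resulting bound does
  not depend on the number of steps.\<close>

lemma euler_bound:
  assumes "0 < h" "b = a + N * h" "0 \<le> K"
    and g: "\<And>t x. t \<in> {a..b} \<Longrightarrow> norm (g t x) \<le> K * (1 + norm x)"
    and t: "t \<in> {a..b}"
  shows "norm (euler g a h N t x) \<le> norm x + (b - a) * (K * (exp (K * (b - a)) * (1 + norm x)))"
proof -
  have node: "a + real j * h \<in> {a..b}" if "j \<le> N" for j
    using that assms(1,2) by (auto intro!: mult_right_mono)
  have pt: "1 + norm (euler_pt g a h x j) \<le> exp (K * (j * h)) * (1 + norm x)" if "j \<le> N" for j
    using that
  proof (induction j)
    case (Suc j)
    have "norm (euler_pt g a h x (Suc j)) \<le> norm (euler_pt g a h x j) + h * (K * (1 + norm (euler_pt g a h x j)))"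
      using g[OF node, of j "euler_pt g a h x j"] Suc.prems \<open>0 < h\<close> 
      by (auto intro!: norm_triangle_le mult_left_mono)
    then have "1 + norm (euler_pt g a h x (Suc j)) \<le> (1 + K * h) * (1 + norm (euler_pt g a h x j))"
      by (simp add: algebra_simps)
    also have "\<dots> \<le> exp (K * h) * (exp (K * (j * h)) * (1 + norm x))"
      using Suc \<open>0 < h\<close> \<open>0 \<le> K\<close> by (intro mult_mono exp_ge_add_one_self) auto
    also have "\<dots> = exp (K * (Suc j * h)) * (1 + norm x)"
      by (simp add: algebra_simps exp_add)
    finally show ?case .
  qed simp
  have gb: "norm (g (a + real j * h) (euler_pt g a h x j)) \<le> K * (exp (K * (b - a)) * (1 + norm x))" if "j < N" for j
  proof -
    have "norm (g (a + real j * h) (euler_pt g a h x j)) \<le> K * (1 + norm (euler_pt g a h x j))"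
      using g node that by simp
    also have "\<dots> \<le> K * (exp (K * (j * h)) * (1 + norm x))"
      using pt[of j] that \<open>0 \<le> K\<close> by (intro mult_left_mono) auto
    also have "\<dots> \<le> K * (exp (K * (b - a)) * (1 + norm x))"
      using that node[of j] \<open>0 \<le> K\<close> by (intro mult_left_mono mult_right_mono) (auto intro!: mult_left_mono)
    finally show ?thesis .
  qed
  have "norm (\<Sum>j<N. max 0 (min (t - (a + j * h)) h) *\<^sub>R g (a + j * h) (euler_pt g a h x j))
    \<le> (\<Sum>j<N. max 0 (min (t - (a + j * h)) h) * (K * (exp (K * (b - a)) * (1 + norm x))))"
    by (rule sum_norm_le) (auto intro!: mult_left_mono gb)
  also have "\<dots> = (t - a) * (K * (exp (K * (b - a)) * (1 + norm x)))"
    using sum_clamp[of h a t N] assms(1,2) t by (simp add: sum_distrib_right[symmetric])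
  also have "\<dots> \<le> (b - a) * (K * (exp (K * (b - a)) * (1 + norm x)))"
    using t \<open>0 \<le> K\<close> by (intro mult_right_mono) auto
  finally show ?thesis unfolding euler_def by (intro norm_triangle_le) auto
qed

text \<open>The initial point may change with the step size, because the homotopy argument later
  selects a different point for each polygon.\<close>

lemma euler_convergence:
  fixes g :: "real \<Rightarrow> 'a::euclidean_space \<Rightarrow> 'a"
  assumes "a < b" and cont: "continuous_on UNIV (\<lambda>(t, x). g t x)"
    and "0 \<le> K" and growth: "\<And>t x. t \<in> {a..b} \<Longrightarrow> norm (g t x) \<le> K * (1 + norm x)"
    and x: "\<And>k. norm (x k) \<le> R"
  defines "\<Phi> \<equiv> (\<lambda>k. euler g a ((b - a) / Suc k) (Suc k))"
  obtains y r where "strict_mono (r :: nat \<Rightarrow> nat)" "continuous_on {a..b} y"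
    "\<And>e. 0 < e \<Longrightarrow> \<exists>N. \<forall>n t. n \<ge> N \<and> t \<in> {a..b} \<longrightarrow> norm (\<Phi> (r n) t (x (r n)) - y t) < e"
    "\<And>t. t \<in> {a..b} \<Longrightarrow> (y has_vector_derivative g t (y t)) (at t within {a..b})"
proof (rule approx_sol_limit[OF \<open>a < b\<close> cont, of "\<lambda>k. (b - a) / Suc k" "\<lambda>k t. \<Phi> k t (x k)"])
  fix k
  have h: "0 < (b - a) / Suc k" "b = a + Suc k * ((b - a) / Suc k)" using \<open>a < b\<close> by (auto simp: field_simps)
  show "approx_sol g a b ((b - a) / Suc k) (\<lambda>t. \<Phi> k t (x k))"
    unfolding \<Phi>_def by (rule euler_approx_sol[OF h])
  fix t assume "t \<in> {a..b}"
  then have "norm (\<Phi> k t (x k)) \<le> norm (x k) + (b - a) * (K * (exp (K * (b - a)) * (1 + norm (x k))))"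
    unfolding \<Phi>_def using euler_bound[OF h \<open>0 \<le> K\<close>, of g t "x k"] growth by simp
  also have "\<dots> \<le> R + (b - a) * (K * (exp (K * (b - a)) * (1 + R)))"
    using x[of k] \<open>a < b\<close> \<open>0 \<le> K\<close> by (intro add_mono mult_left_mono) auto
  finally show "norm (\<Phi> k t (x k)) \<le> R + (b - a) * (K * (exp (K * (b - a)) * (1 + R)))" .
next
  show "(\<lambda>k. (b - a) / Suc k) \<longlonglongrightarrow> 0" by real_asymp
next
  fix y and r :: "nat \<Rightarrow> nat"
  assume "strict_mono r" "continuous_on {a..b} y"
    "\<And>e. 0 < e \<Longrightarrow> \<exists>N. \<forall>n t. n \<ge> N \<and> t \<in> {a..b} \<longrightarrow> norm (\<Phi> (r n) t (x (r n)) - y t) < e"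
    "\<And>t. t \<in> {a..b} \<Longrightarrow> (y has_vector_derivative g t (y t)) (at t within {a..b})"
  then show thesis by (rule that)
qed

text \<open>Existence on the whole interval is what the linear matrix equations in
  \<open>congruence_path\<close> call for.\<close>

lemma peano_linear_growth:
  fixes g :: "real \<Rightarrow> 'a::euclidean_space \<Rightarrow> 'a"
  assumes "a < b" and cont: "continuous_on UNIV (\<lambda>(t, x). g t x)"
    and "0 \<le> K" and growth: "\<And>t x. t \<in> {a..b} \<Longrightarrow> norm (g t x) \<le> K * (1 + norm x)"
  shows "\<exists>y. y a = x \<and> continuous_on {a..b} y \<and>
    (\<forall>t\<in>{a..b}. (y has_vector_derivative g t (y t)) (at t within {a..b}))"
proof -
  obtain y and r :: "nat \<Rightarrow> nat" where y: "continuous_on {a..b} y"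
    "\<And>e. 0 < e \<Longrightarrow> \<exists>N. \<forall>n t. n \<ge> N \<and> t \<in> {a..b} \<longrightarrow> norm (euler g a ((b - a) / Suc (r n)) (Suc (r n)) t x - y t) < e"
    "\<And>t. t \<in> {a..b} \<Longrightarrow> (y has_vector_derivative g t (y t)) (at t within {a..b})"
    by (rule euler_convergence[OF assms, of "\<lambda>_. x" "norm x"]) auto
  have lt: "norm (x - y a) < e" if e: "0 < e" for e
  proof -
    obtain N where "\<forall>n t. n \<ge> N \<and> t \<in> {a..b} \<longrightarrow> norm (euler g a ((b - a) / Suc (r n)) (Suc (r n)) t x - y t) < e"
      using y(2)[OF e] by blast
    then have "norm (euler g a ((b - a) / Suc (r N)) (Suc (r N)) a x - y a) < e"
      using \<open>a < b\<close> by auto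
    then show ?thesis using \<open>a < b\<close> by (simp add: euler_start)
  qed
  have "x = y a" using lt[of "norm (x - y a)"] by (cases "x = y a") auto
  with y(1,3) show ?thesis by auto
qed

section \<open>Symmetric pencils and a homotopy argument\<close>

lemma bounded_bilinear_sp: "is_scalar_product sp \<Longrightarrow> bounded_bilinear sp"
  by (simp add: is_scalar_product_def bilinear_conv_bounded_bilinear)

lemma sp_sym: "is_scalar_product sp \<Longrightarrow> sp x y = sp y x"
  by (auto simp: is_scalar_product_def)

lemma sp_pos: "is_scalar_product sp \<Longrightarrow> x \<noteq> 0 \<Longrightarrow> 0 < sp x x"
  by (auto simp: is_scalar_product_def)

lemmas sp_algebra =
  bounded_bilinear.add_left[OF bounded_bilinear_sp] bounded_bilinear.add_right[OF bounded_bilinear_sp]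
  bounded_bilinear.diff_left[OF bounded_bilinear_sp] bounded_bilinear.diff_right[OF bounded_bilinear_sp]
  bounded_bilinear.minus_left[OF bounded_bilinear_sp] bounded_bilinear.minus_right[OF bounded_bilinear_sp]
  bounded_bilinear.scaleR_left[OF bounded_bilinear_sp] bounded_bilinear.scaleR_right[OF bounded_bilinear_sp]
  bounded_bilinear.zero_left[OF bounded_bilinear_sp] bounded_bilinear.zero_right[OF bounded_bilinear_sp]

lemma bounded_bilinear_matrix_vector: "bounded_bilinear (\<lambda>(A::real^'n^'m) x. A *v x)"
  by (simp only: bilinear_conv_bounded_bilinear[symmetric])
    (auto simp: bilinear_def linear_iff matrix_vector_mult_add_rdistrib matrix_vector_right_distrib
      matrix_scaleR_vector_ac scaleR_matrix_vector_assoc)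

lemma matrix_matrix_mult_add_right:
  fixes A B :: "'a::semiring_1^'n^'m"
  shows "(A + B) ** C = A ** C + B ** C"
  by (vector matrix_matrix_mult_def sum.distrib[symmetric] distrib_right)

lemma bounded_bilinear_matrix_matrix: "bounded_bilinear (\<lambda>(A::real^'n^'m) (B::real^'k^'n). A ** B)"
  by (simp only: bilinear_conv_bounded_bilinear[symmetric])
    (auto simp: bilinear_def linear_iff matrix_add_ldistrib matrix_matrix_mult_add_right
      scalar_matrix_assoc matrix_scalar_ac)

lemmas matvec_algebra =
  bounded_bilinear.add_left[OF bounded_bilinear_matrix_vector] bounded_bilinear.add_right[OF bounded_bilinear_matrix_vector]
  bounded_bilinear.diff_left[OF bounded_bilinear_matrix_vector] bounded_bilinear.diff_right[OF bounded_bilinear_matrix_vector]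
  bounded_bilinear.minus_left[OF bounded_bilinear_matrix_vector] bounded_bilinear.minus_right[OF bounded_bilinear_matrix_vector]
  bounded_bilinear.scaleR_left[OF bounded_bilinear_matrix_vector] bounded_bilinear.scaleR_right[OF bounded_bilinear_matrix_vector]
  bounded_bilinear.zero_left[OF bounded_bilinear_matrix_vector] bounded_bilinear.zero_right[OF bounded_bilinear_matrix_vector]

lemmas continuous_on_matvec [continuous_intros] =
  bounded_bilinear.continuous_on[OF bounded_bilinear_matrix_vector]

lemmas continuous_on_sp = bounded_bilinear.continuous_on[OF bounded_bilinear_sp]

lemma continuous_on_form:
  assumes "is_scalar_product sp" "continuous_on T A"
  shows "continuous_on (T \<times> X) (\<lambda>(t, x). sp (A t *v x) x)"
  unfolding split_def
  by (intro continuous_on_sp[OF assms(1)] continuous_intros continuous_on_compose2[OF assms(2)]) auto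

lemma form_scaleR:
  assumes "is_scalar_product sp"
  shows "sp (A *v (c *\<^sub>R x)) (c *\<^sub>R x) = c\<^sup>2 * sp (A *v x) x"
  by (simp add: sp_algebra[OF assms] matvec_algebra power2_eq_square)

text \<open>By homogeneity, the minimum over the compact set of times and unit vectors serves. This
  turns bounds on \<open>V\<close> into norm bounds that are uniform on compact time
  intervals.\<close>

lemma form_coercive:
  fixes A :: "real \<Rightarrow> real^'n^'n"
  assumes sp: "is_scalar_product sp" and A: "continuous_on {a..b} A"
    and pos: "\<And>t. t \<in> {a..b} \<Longrightarrow> pos_def_on sp UNIV (A t)"
  shows "\<exists>m>0. \<forall>t\<in>{a..b}. \<forall>x. m * (norm x)\<^sup>2 \<le> sp (A t *v x) x"
proof (cases "{a..b} = {}")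
  case False
  let ?K = "{a..b} \<times> sphere (0::real^'n) 1"
  obtain x0 :: "real^'n" where "norm x0 = 1" using vector_choose_size zero_le_one by blast
  then have "?K \<noteq> {}" using False by auto
  moreover have "compact ?K" by (intro compact_Times) auto
  ultimately obtain p where p: "p \<in> ?K"
    "\<And>q. q \<in> ?K \<Longrightarrow> (\<lambda>(t, x). sp (A t *v x) x) p \<le> (\<lambda>(t, x). sp (A t *v x) x) q"
    using continuous_attains_inf[of ?K "\<lambda>(t, x). sp (A t *v x) x"] continuous_on_form[OF sp A] by blast
  obtain t0 y0 where p0: "p = (t0, y0)" by fastforce
  define m where "m = sp (A t0 *v y0) y0"
  have "y0 \<noteq> 0" using p(1) by (auto simp: p0)
  then have "0 < m" using p(1) pos[of t0] by (simp add: m_def p0 pos_def_on_def)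
  moreover have "m * (norm x)\<^sup>2 \<le> sp (A t *v x) x" if t: "t \<in> {a..b}" for t x
  proof (cases "x = 0")
    case False
    then have "m \<le> sp (A t *v (x /\<^sub>R norm x)) (x /\<^sub>R norm x)"
      using p(2)[of "(t, x /\<^sub>R norm x)"] t by (simp add: p0 m_def)
    then show ?thesis unfolding form_scaleR[OF sp] using False by (simp add: field_simps)
  qed (simp add: sp_algebra[OF sp])
  ultimately show ?thesis by blast
qed (auto intro: exI[of _ 1])

section \<open>Extreme characteristic values of a symmetric pencil\<close>

lemma quadratic_nonneg_imp_zero:
  fixes a b :: real
  assumes "\<And>e. 0 \<le> a * e + b * e\<^sup>2"
  shows "a = 0"
proof (rule ccontr)
  assume a: "a \<noteq> 0"
  \<comment> \<open>As \<open>c\<close> is positive and exceeds \<open>b\<close> by at least one,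
    the test value \<open>e = - a / c\<close> makes the expression at most
    \<open>- (a\<^sup>2 / c\<^sup>2)\<close>.\<close>
  define c where "c = \<bar>b\<bar> + 1"
  have c: "0 < c" "b \<le> c - 1" by (auto simp: c_def)
  have "0 \<le> a * (- a / c) + b * (- a / c)\<^sup>2" by (rule assms)
  also have "\<dots> \<le> a * (- a / c) + (c - 1) * (- a / c)\<^sup>2"
    using c by (intro add_left_mono mult_right_mono) auto
  also have "\<dots> = - (a\<^sup>2 / c\<^sup>2)" using c by (simp add: field_simps power2_eq_square)
  also have "\<dots> < 0" using a c by simp
  finally show False by simp
qed

text \<open>A zero of a nonnegative form is a minimum, so the first variation
  \<open>2 * sp (C *v x) y\<close> vanishes in every direction \<open>y\<close>.\<close>

lemma semidefinite_kernel:
  assumes sp: "is_scalar_product sp" and C: "symmetric_op sp C"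
    and nn: "\<And>x. 0 \<le> sp (C *v x) x" and x: "sp (C *v x) x = 0"
  shows "C *v x = 0"
proof -
  have "2 * sp (C *v x) y = 0" for y
  proof (rule quadratic_nonneg_imp_zero)
    fix e
    have "sp (C *v y) x = sp (C *v x) y"
      using C sp_sym[OF sp] unfolding symmetric_op_def by metis
    then have "sp (C *v (x + e *\<^sub>R y)) (x + e *\<^sub>R y) = 2 * sp (C *v x) y * e + sp (C *v y) y * e\<^sup>2"
      using x by (simp add: sp_algebra[OF sp] matvec_algebra power2_eq_square algebra_simps)
    then show "0 \<le> 2 * sp (C *v x) y * e + sp (C *v y) y * e\<^sup>2" using nn by metis
  qed
  then have "sp (C *v x) (C *v x) = 0" by simp
  then show ?thesis using sp_pos[OF sp] by fastforce
qed

lemma symmetric_op_diff_scaleR: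
  assumes "is_scalar_product sp" "symmetric_op sp A" "symmetric_op sp B"
  shows "symmetric_op sp (A - l *\<^sub>R B)"
  using assms(2,3) unfolding symmetric_op_def
  by (simp add: matvec_algebra sp_algebra[OF assms(1)])

text \<open>A minimizer of the Rayleigh quotient on the unit sphere is a zero of the nonnegative
  form of \<open>A - m *\<^sub>R B\<close>, hence lies in the kernel of that operator.\<close>

lemma rayleigh_min:
  fixes A B :: "real^'n^'n"
  assumes sp: "is_scalar_product sp" and A: "symmetric_op sp A" and B: "symmetric_op sp B"
    and pos: "pos_def_on sp UNIV B"
  shows "\<exists>x m. x \<noteq> 0 \<and> A *v x = m *\<^sub>R (B *v x) \<and> (\<forall>y. m * sp (B *v y) y \<le> sp (A *v y) y)"
proof -
  let ?r = "\<lambda>x. sp (A *v x) x / sp (B *v x) x"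
  have B0: "0 < sp (B *v x) x" if "x \<noteq> 0" for x using pos that by (simp add: pos_def_on_def)
  have "sp (B *v x) x \<noteq> 0" if "x \<in> sphere 0 1" for x
    using B0[of x] that by (cases "x = 0") auto
  then have "continuous_on (sphere 0 1) ?r"
    by (intro continuous_intros continuous_on_sp[OF sp]) blast
  moreover obtain x0 :: "real^'n" where "norm x0 = 1" using vector_choose_size zero_le_one by blast
  moreover have "compact (sphere (0::real^'n) 1)" by simp
  ultimately obtain x where x: "norm x = 1" "\<And>y. norm y = 1 \<Longrightarrow> ?r x \<le> ?r y"
    using continuous_attains_inf[of "sphere 0 1" ?r] by fastforce
  have x0: "x \<noteq> 0" using x(1) by auto
  define m where "m = ?r x"
  have le: "m * sp (B *v y) y \<le> sp (A *v y) y" for y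
  proof (cases "y = 0")
    case False
    have "m \<le> ?r (y /\<^sub>R norm y)" unfolding m_def using False by (intro x(2)) simp
    also have "\<dots> = ?r y" unfolding form_scaleR[OF sp] using False by simp
    finally show ?thesis using B0[OF False] by (simp add: field_simps)
  qed (simp add: sp_algebra[OF sp])
  have "(A - m *\<^sub>R B) *v x = 0"
  proof (rule semidefinite_kernel[OF sp])
    show "symmetric_op sp (A - m *\<^sub>R B)" by (rule symmetric_op_diff_scaleR[OF sp A B])
    show "0 \<le> sp ((A - m *\<^sub>R B) *v y) y" for y
      using le[of y] by (simp add: matvec_algebra sp_algebra[OF sp])
    show "sp ((A - m *\<^sub>R B) *v x) x = 0"
      using B0[OF x0] by (simp add: matvec_algebra sp_algebra[OF sp] m_def)
  qed
  then have "A *v x = m *\<^sub>R (B *v x)" by (simp add: matvec_algebra)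
  with x0 le show ?thesis by blast
qed

lemma det_eq_0_iff_kernel:
  fixes C :: "real^'n^'n"
  shows "det C = 0 \<longleftrightarrow> (\<exists>x. x \<noteq> 0 \<and> C *v x = 0)"
  using invertible_det_nz[of C] invertible_left_inverse[of C] matrix_left_invertible_ker[of C] by blast

lemma char_values_iff:
  "l \<in> char_values A B \<longleftrightarrow> (\<exists>x. x \<noteq> 0 \<and> A *v x = l *\<^sub>R (B *v x))"
  by (simp add: char_values_def det_eq_0_iff_kernel matvec_algebra)

text \<open>The determinant is a polynomial in the parameter, and a single non-root shows that it is
  not the zero polynomial.\<close>

lemma finite_char_values:
  fixes A B :: "real^'n^'n"
  assumes "l \<notin> char_values A B"
  shows "finite (char_values A B)"
proof -
  have "real_polynomial_function (\<lambda>l. det (A - l *\<^sub>R B))"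
  proof -
    have "real_polynomial_function (\<lambda>l. A $ i $ j + (- B $ i $ j) * l)" for i j
      by (intro real_polynomial_function.intros) (rule bounded_linear_ident)
    then have "real_polynomial_function (\<lambda>l. A $ i $ j - l * B $ i $ j)" for i j
      by (simp add: algebra_simps)
    then show ?thesis unfolding det_def
      by (intro real_polynomial_function_sum real_polynomial_function.intros(2,4)
          real_polynomial_function_prod finite_permutations) auto
  qed
  then obtain a n where an: "(\<lambda>l. det (A - l *\<^sub>R B)) = (\<lambda>x. \<Sum>i\<le>n. a i * x^i)"
    unfolding real_polynomial_function_iff_sum by blast
  have "\<exists>i\<le>n. a i \<noteq> 0"
  proof (rule ccontr)
    assume "\<not> (\<exists>i\<le>n. a i \<noteq> 0)"
    then have "det (A - l *\<^sub>R B) = 0" using fun_cong[OF an, of l] by simp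
    then show False using assms by (simp add: char_values_def)
  qed
  then show ?thesis
    unfolding char_values_def fun_cong[OF an] using Transcendental.polyfun_finite_roots by blast
qed

lemma char_bounds:
  fixes A B :: "real^'n^'n"
  assumes sp: "is_scalar_product sp" and A: "symmetric_op sp A" and B: "symmetric_op sp B"
    and pos: "pos_def_on sp UNIV B"
  shows "min_char A B * sp (B *v y) y \<le> sp (A *v y) y"
    and "sp (A *v y) y \<le> max_char A B * sp (B *v y) y"
proof -
  have B0: "0 < sp (B *v x) x" if "x \<noteq> 0" for x using pos that by (simp add: pos_def_on_def)
  obtain x m where m: "x \<noteq> 0" "A *v x = m *\<^sub>R (B *v x)" "\<And>y. m * sp (B *v y) y \<le> sp (A *v y) y"
    using rayleigh_min[OF assms] by blast
  \<comment> \<open>The upper estimate is the lower one for \<open>- A\<close>, with the multiplier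
    negated.\<close>
  have "symmetric_op sp (- A)"
    using A by (simp add: symmetric_op_def matvec_algebra sp_algebra[OF sp])
  then obtain x' m' where m': "x' \<noteq> 0" "(- A) *v x' = m' *\<^sub>R (B *v x')"
    "\<And>y. m' * sp (B *v y) y \<le> sp ((- A) *v y) y"
    using rayleigh_min[OF sp _ B pos] by blast
  have ge: "m \<le> l" if "l \<in> char_values A B" for l
  proof -
    obtain z where z: "z \<noteq> 0" "A *v z = l *\<^sub>R (B *v z)" using \<open>l \<in> _\<close> char_values_iff by blast
    then show ?thesis using m(3)[of z] B0[of z] by (simp add: sp_algebra[OF sp])
  qed
  \<comment> \<open>Every characteristic value is at least \<open>m\<close>, so \<open>m - 1\<close>
    is a non-root; the finiteness obtained from it gives \<open>Min\<close> and \<open>Max\<close>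
    their meaning.\<close>
  then have "m - 1 \<notin> char_values A B" by fastforce
  then have fin: "finite (char_values A B)" by (rule finite_char_values)
  have "min_char A B \<le> m" unfolding min_char_def
    using fin m(1,2) char_values_iff by (intro Min_le) blast+
  moreover have "0 \<le> sp (B *v y) y" using B0[of y] by (cases "y = 0") (auto simp: sp_algebra[OF sp])
  ultimately show "min_char A B * sp (B *v y) y \<le> sp (A *v y) y"
    using m(3)[of y] mult_right_mono[of "min_char A B" m "sp (B *v y) y"] by linarith
  have "A *v x' = (- m') *\<^sub>R (B *v x')" using m'(2)
    by (metis add.inverse_inverse bounded_bilinear.minus_left[OF bounded_bilinear_matrix_vector] scaleR_minus_left)
  then have "- m' \<le> max_char A B" unfolding max_char_def
    using fin m'(1) char_values_iff by (intro Max_ge) blast+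
  then show "sp (A *v y) y \<le> max_char A B * sp (B *v y) y"
    using m'(3)[of y] \<open>0 \<le> sp (B *v y) y\<close> mult_right_mono[of "- m'" "max_char A B" "sp (B *v y) y"]
    by (simp add: matvec_algebra sp_algebra[OF sp])
qed

section \<open>Families of forms and matrices depending on a parameter\<close>

lemma has_real_derivative_form:
  assumes sp: "is_scalar_product sp" and sym: "symmetric_op sp (A t)"
    and A: "(A has_vector_derivative A') (at t within I)"
    and x: "(x has_vector_derivative x') (at t within I)"
  shows "((\<lambda>t. sp (A t *v x t) (x t)) has_real_derivative
    2 * sp (A t *v x') (x t) + sp (A' *v x t) (x t)) (at t within I)"
proof -
  have "((\<lambda>t. A t *v x t) has_vector_derivative (A t *v x' + A' *v x t)) (at t within I)"
    by (rule bounded_bilinear.has_vector_derivative[OF bounded_bilinear_matrix_vector A x])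
  from bounded_bilinear.has_vector_derivative[OF bounded_bilinear_sp[OF sp] this x]
  have "((\<lambda>t. sp (A t *v x t) (x t)) has_vector_derivative
    sp (A t *v x t) x' + sp (A t *v x' + A' *v x t) (x t)) (at t within I)" .
  moreover have "sp (A t *v x t) x' = sp (A t *v x') (x t)"
    using sym sp_sym[OF sp] unfolding symmetric_op_def by metis
  ultimately show ?thesis
    by (simp add: has_real_derivative_iff_has_vector_derivative sp_algebra[OF sp] algebra_simps)
qed

text \<open>Makes \<open>char_bounds\<close> available for the pencils formed with the derivatives
  of \<open>S\<close> and \<open>B\<close>.\<close>

lemma symmetric_op_derivative:
  assumes sp: "is_scalar_product sp" and sym: "\<And>t. symmetric_op sp (A t)"
    and A: "(A has_vector_derivative A') (at t)"
  shows "symmetric_op sp A'"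
  unfolding symmetric_op_def
proof (intro allI)
  fix x y
  have v: "((\<lambda>t. A t *v z) has_vector_derivative A' *v z) (at t)" for z
    using bounded_bilinear.has_vector_derivative[OF bounded_bilinear_matrix_vector A has_vector_derivative_const[of z]]
    by simp
  have "((\<lambda>t. sp (A t *v x) y) has_vector_derivative sp (A' *v x) y) (at t)"
    using bounded_bilinear.has_vector_derivative[OF bounded_bilinear_sp[OF sp] v has_vector_derivative_const[of y]]
    by (simp add: sp_algebra[OF sp])
  moreover have "((\<lambda>t. sp x (A t *v y)) has_vector_derivative sp x (A' *v y)) (at t)"
    using bounded_bilinear.has_vector_derivative[OF bounded_bilinear_sp[OF sp] has_vector_derivative_const[of x] v]
    by (simp add: sp_algebra[OF sp])
  moreover have "(\<lambda>t. sp (A t *v x) y) = (\<lambda>t. sp x (A t *v y))"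
    using sym by (simp add: symmetric_op_def)
  ultimately show "sp (A' *v x) y = sp x (A' *v y)"
    using vector_derivative_unique_at by metis
qed

lemma matrix_inv_mult:
  fixes A :: "real^'n^'n"
  assumes "invertible A"
  shows "A ** matrix_inv A = mat 1" "matrix_inv A ** A = mat 1"
  using someI_ex[OF assms[unfolded invertible_def]] unfolding matrix_inv_def by auto

text \<open>Cramer's rule writes each entry of the inverse as a quotient of determinants.\<close>

lemma continuous_on_matrix_inv:
  fixes A :: "'a::topological_space \<Rightarrow> real^'n^'n"
  assumes A: "continuous_on T A" and inv: "\<And>t. t \<in> T \<Longrightarrow> invertible (A t)"
  shows "continuous_on T (\<lambda>t. matrix_inv (A t))"
proof -
  have det: "continuous_on T (\<lambda>t. det (C t))"
    if "\<And>i j. continuous_on T (\<lambda>t. C t $ i $ j)" for C :: "'a \<Rightarrow> real^'n^'n"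
    unfolding det_def by (intro continuous_intros that)
  have comp: "continuous_on T (\<lambda>t. A t $ i $ j)" for i j by (intro continuous_intros A)
  have eq: "matrix_inv (A t) $ k $ l =
      det (\<chi> i j. if j = k then axis l 1 $ i else A t $ i $ j) / det (A t)"
    if "t \<in> T" for t k l
  proof -
    have "A t *v (matrix_inv (A t) *v axis l 1) = axis l 1"
      by (simp add: matrix_vector_mul_assoc matrix_inv_mult inv that)
    then have "(matrix_inv (A t) *v axis l 1) $ k =
        det (\<chi> i j. if j = k then axis l 1 $ i else A t $ i $ j) / det (A t)"
      using cramer[of "A t" "matrix_inv (A t) *v axis l 1" "axis l 1"] inv that
      by (simp add: invertible_det_nz)
    then show ?thesis by (simp add: matrix_vector_mult_basis column_def)
  qed
  have "continuous_on T (\<lambda>t. matrix_inv (A t) $ k $ l)" for k l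
  proof -
    have "continuous_on T (\<lambda>t. det (\<chi> i j. if j = k then axis l 1 $ i else A t $ i $ j) / det (A t))"
    proof (intro continuous_on_divide det)
      show "continuous_on T (\<lambda>t. (\<chi> i j. if j = k then axis l 1 $ i else A t $ i $ j) $ i $ j)" for i j
        using comp by (cases "j = k") auto
    qed (use inv comp in \<open>auto simp: invertible_det_nz\<close>)
    then show ?thesis by (simp cong: continuous_on_cong add: eq)
  qed
  then have "continuous_on T (\<lambda>t. \<chi> k l. matrix_inv (A t) $ k $ l)"
    by (intro continuous_on_vec_lambda)
  then show ?thesis by simp
qed

section \<open>A consequence of Brouwer's theorem\<close>

text \<open>A general form replaces the norm because the boundary of the initial ball has to be a
  level set of \<open>V\<close> at the initial time. Convexity rests on
  \<open>u * v * \<beta> (x - y) (x - y) \<ge> 0\<close>.\<close>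

lemma ball_sp_compact_convex:
  fixes \<beta> :: "real^'n \<Rightarrow> real^'n \<Rightarrow> real"
  assumes \<beta>: "is_scalar_product \<beta>" and L: "subspace L"
  shows "compact {x \<in> L. \<beta> x x \<le> C}" "convex {x \<in> L. \<beta> x x \<le> C}"
proof -
  have "pos_def_on \<beta> UNIV (mat 1)" using sp_pos[OF \<beta>] by (simp add: pos_def_on_def)
  then have "\<exists>m>0. \<forall>t\<in>{0..0::real}. \<forall>x. m * (norm x)\<^sup>2 \<le> \<beta> (mat 1 *v x) x"
    by (intro form_coercive[OF \<beta>, where A="\<lambda>_. mat 1"]) simp_all
  then obtain m where m: "0 < m" "\<And>x. m * (norm x)\<^sup>2 \<le> \<beta> x x" by auto
  have cont: "continuous_on S (\<lambda>x. \<beta> x x)" for S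
    by (intro continuous_on_sp[OF \<beta>] continuous_intros)
  have "closed (L \<inter> {x. \<beta> x x \<le> C})"
    using closed_subspace[OF L] by (intro closed_Int closed_Collect_le cont) auto
  moreover have "{x \<in> L. \<beta> x x \<le> C} = L \<inter> {x. \<beta> x x \<le> C}" by auto
  moreover have "bounded {x \<in> L. \<beta> x x \<le> C}"
  proof (rule boundedI)
    fix x assume "x \<in> {x \<in> L. \<beta> x x \<le> C}"
    then have "m * (norm x)\<^sup>2 \<le> C" using m(2)[of x] by simp
    then have "(norm x)\<^sup>2 \<le> C / m" using m(1) by (simp add: field_simps)
    then show "norm x \<le> sqrt (C / m)" by (rule real_le_rsqrt)
  qed
  ultimately show "compact {x \<in> L. \<beta> x x \<le> C}" by (simp add: compact_eq_bounded_closed)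
  show "convex {x \<in> L. \<beta> x x \<le> C}"
  proof (rule convexI)
    fix x y and u v :: real
    assume x: "x \<in> {x \<in> L. \<beta> x x \<le> C}" and y: "y \<in> {x \<in> L. \<beta> x x \<le> C}"
      and uv: "0 \<le> u" "0 \<le> v" "u + v = 1"
    have "0 \<le> \<beta> (x - y) (x - y)"
      using sp_pos[OF \<beta>, of "x - y"] by (cases "x = y") (auto simp: sp_algebra[OF \<beta>])
    then have "u * v * (2 * \<beta> x y) \<le> u * v * (\<beta> x x + \<beta> y y)"
      using uv by (intro mult_left_mono) (auto simp: sp_algebra[OF \<beta>] sp_sym[OF \<beta>, of y x])
    moreover have "\<beta> (u *\<^sub>R x + v *\<^sub>R y) (u *\<^sub>R x + v *\<^sub>R y) = u * u * \<beta> x x + v * v * \<beta> y y + u * v * (2 * \<beta> x y)"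
      by (simp add: sp_algebra[OF \<beta>] sp_sym[OF \<beta>, of y x] algebra_simps)
    ultimately have "\<beta> (u *\<^sub>R x + v *\<^sub>R y) (u *\<^sub>R x + v *\<^sub>R y) \<le> (u + v) * (u * \<beta> x x + v * \<beta> y y)"
      by (simp add: algebra_simps)
    also have "\<dots> \<le> u * C + v * C" using x y uv by (auto intro!: add_mono mult_left_mono)
    also have "\<dots> = C" using uv by (simp add: distrib_right[symmetric])
    finally show "u *\<^sub>R x + v *\<^sub>R y \<in> {x \<in> L. \<beta> x x \<le> C}"
      using x y L by (auto simp: subspace_add subspace_mul)
  qed
qed

text \<open>Otherwise the homotopy, run radially in a collar of the boundary, would give a retraction of
  the ball onto its boundary; its negative contradicts Brouwer's theorem.\<close>

lemma homotopy_zero: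
  fixes \<beta> :: "real^'n \<Rightarrow> real^'n \<Rightarrow> real" and a b :: real
  assumes \<beta>: "is_scalar_product \<beta>" and L: "subspace L" and "0 < C" "a \<le> b"
    and cont: "continuous_on ({a..b} \<times> {x \<in> L. \<beta> x x \<le> C}) (\<lambda>(t, x). H t x)"
    and HL: "\<And>t x. t \<in> {a..b} \<Longrightarrow> x \<in> L \<Longrightarrow> \<beta> x x \<le> C \<Longrightarrow> H t x \<in> L"
    and start: "\<And>x. x \<in> L \<Longrightarrow> \<beta> x x = C \<Longrightarrow> H a x = x"
  shows "\<exists>t\<in>{a..b}. \<exists>x\<in>L. \<beta> x x \<le> C \<and> (t = b \<or> \<beta> x x = C) \<and> H t x = 0"
proof (rule ccontr)
  assume no: "\<not> ?thesis"
  let ?D = "{x \<in> L. \<beta> x x \<le> C}"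
  \<comment> \<open>\<open>\<rho>\<close> is the gauge of the ball, cut off from below at one half.
    The inner half-size ball is magnified to the whole ball and sees \<open>H\<close> at time
    \<open>b\<close>; in the remaining collar \<open>x /\<^sub>R \<rho> x\<close> stays on the
    boundary while \<open>\<tau>\<close> runs from \<open>b\<close> back to
    \<open>a\<close>.\<close>
  define \<rho> where "\<rho> = (\<lambda>x. max (1/2) (sqrt (\<beta> x x / C)))"
  define \<tau> where "\<tau> = (\<lambda>x. a + 2 * (1 - \<rho> x) * (b - a))"
  define k where "k = (\<lambda>x. H (\<tau> x) (x /\<^sub>R \<rho> x))"
  \<comment> \<open>Rescaling sends \<open>k x\<close> to the boundary. A fixed point of
    \<open>r\<close> therefore lies on the boundary, where \<open>k x = x\<close>, and would equal
    its own negative.\<close>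
  define r where "r = (\<lambda>x. - (sqrt (C / \<beta> (k x) (k x)) *\<^sub>R k x))"
  have nn: "0 \<le> \<beta> x x" for x using sp_pos[OF \<beta>, of x] by (cases "x = 0") (auto simp: sp_algebra[OF \<beta>])
  have \<rho>: "1/2 \<le> \<rho> x" "x \<in> ?D \<Longrightarrow> \<rho> x \<le> 1" for x
    using \<open>0 < C\<close> by (auto simp: \<rho>_def)
  have \<tau>: "\<tau> x \<in> {a..b}" if "x \<in> ?D" for x
  proof -
    have "0 \<le> 2 * (1 - \<rho> x) * (b - a)" using \<rho>[of x] that \<open>a \<le> b\<close> by simp
    moreover have "2 * (1 - \<rho> x) * (b - a) \<le> 1 * (b - a)"
      using \<rho>[of x] that \<open>a \<le> b\<close> by (intro mult_right_mono) auto
    ultimately show ?thesis by (simp add: \<tau>_def)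
  qed
  have sc: "\<beta> (x /\<^sub>R \<rho> x) (x /\<^sub>R \<rho> x) = \<beta> x x / (\<rho> x)\<^sup>2" for x
    by (simp add: sp_algebra[OF \<beta>] power2_eq_square divide_inverse)
  have \<rho>2: "\<beta> x x \<le> C * (\<rho> x)\<^sup>2" for x
  proof -
    have "\<beta> x x / C = (sqrt (\<beta> x x / C))\<^sup>2" using nn \<open>0 < C\<close> by simp
    also have "\<dots> \<le> (\<rho> x)\<^sup>2" using nn \<open>0 < C\<close> by (intro power_mono) (auto simp: \<rho>_def)
    finally show ?thesis using \<open>0 < C\<close> by (simp add: field_simps)
  qed
  have xD: "x /\<^sub>R \<rho> x \<in> ?D" if "x \<in> ?D" for x
  proof -
    have "0 < \<rho> x" using \<rho>(1)[of x] by linarith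
    then have "\<beta> x x / (\<rho> x)\<^sup>2 \<le> C" using \<rho>2[of x] by (simp add: field_simps)
    then show ?thesis using that L sc[of x] by (simp add: subspace_mul)
  qed
  have kL: "k x \<in> L" if "x \<in> ?D" for x
    using HL[OF \<tau>[OF that]] xD[OF that] by (simp add: k_def)
  have k0: "k x \<noteq> 0" if "x \<in> ?D" for x
  proof
    assume k: "k x = 0"
    have "\<tau> x = b \<or> \<beta> (x /\<^sub>R \<rho> x) (x /\<^sub>R \<rho> x) = C"
    proof (cases "\<rho> x = 1/2")
      case False
      then have "\<rho> x = sqrt (\<beta> x x / C)" by (auto simp: \<rho>_def max_def split: if_splits)
      then have "(\<rho> x)\<^sup>2 = \<beta> x x / C" using nn \<open>0 < C\<close> by simp
      moreover have "0 < (\<rho> x)\<^sup>2" using \<rho>(1)[of x] by (intro zero_less_power) linarith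
      ultimately show ?thesis unfolding sc using \<open>0 < C\<close> by (simp add: field_simps)
    next
      case True
      show ?thesis unfolding \<tau>_def True by simp
    qed
    then show False using no k \<tau>[OF that] xD[OF that] unfolding k_def by blast
  qed
  have c\<beta>: "continuous_on S (\<lambda>x. \<beta> x x)" for S
    by (intro continuous_on_sp[OF \<beta>] continuous_intros)
  have c\<rho>: "continuous_on ?D \<rho>" unfolding \<rho>_def
    by (intro continuous_intros c\<beta>) (use \<open>0 < C\<close> in auto)
  have ck: "continuous_on ?D k"
  proof -
    have "\<rho> x \<noteq> 0" for x using \<rho>(1)[of x] by linarith
    then have "continuous_on ?D (\<lambda>x. (\<tau> x, x /\<^sub>R \<rho> x))"
      unfolding \<tau>_def by (intro continuous_intros c\<rho>) auto
    from continuous_on_compose2[OF cont this] show ?thesis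
      unfolding k_def using \<tau> xD by fastforce
  qed
  have pos: "0 < \<beta> (k x) (k x)" if "x \<in> ?D" for x using sp_pos[OF \<beta>] k0[OF that] by blast
  have cr: "continuous_on ?D r" unfolding r_def
    by (intro continuous_intros ck continuous_on_sp[OF \<beta>]) (use pos in force)
  have rC: "\<beta> (r x) (r x) = C" if "x \<in> ?D" for x
    using pos[OF that] \<open>0 < C\<close> by (simp add: r_def sp_algebra[OF \<beta>] mult.assoc[symmetric])
  have rD: "r x \<in> ?D" if "x \<in> ?D" for x
    using rC[OF that] kL[OF that] L by (simp add: r_def subspace_mul subspace_neg)
  have "?D \<noteq> {}" using subspace_0[OF L] \<open>0 < C\<close> by (force simp: sp_algebra[OF \<beta>])
  then obtain x where x: "x \<in> ?D" "r x = x"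
    using brouwer[OF ball_sp_compact_convex[OF \<beta> L] _ cr] rD by blast
  then have xC: "\<beta> x x = C" using rC by metis
  then have "\<rho> x = 1" using \<open>0 < C\<close> by (simp add: \<rho>_def)
  then have "k x = x" using start[of x] x xC by (simp add: k_def \<tau>_def)
  then have "x = - x" using x(2) xC \<open>0 < C\<close> by (simp add: r_def)
  then have "2 *\<^sub>R x = 0" by (simp add: scaleR_2 eq_neg_iff_add_eq_0)
  then have "x = 0" by simp
  then show False using xC \<open>0 < C\<close> by (simp add: sp_algebra[OF \<beta>])
qed

section \<open>The guiding pair of quadratic forms\<close>

lemma last_time_at_level:
  fixes w :: "real \<Rightarrow> real"
  assumes cont: "continuous_on {a..b} w" and "a \<le> b" "w a \<le> c" "c < w b"
  shows "\<exists>s\<in>{a..<b}. w s = c \<and> (\<forall>t\<in>{s<..b}. c < w t)"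
proof -
  let ?K = "{a..b} \<inter> w -` {..c}"
  have "closed ?K" by (intro continuous_closed_preimage cont) auto
  moreover have "bounded ?K" by (rule bounded_subset[of "{a..b}"]) auto
  ultimately have "compact ?K" by (simp add: compact_eq_bounded_closed)
  moreover have "?K \<noteq> {}" using assms by auto
  ultimately obtain s where "s \<in> ?K" "\<forall>t\<in>?K. t \<le> s"
    using compact_attains_sup by blast
  then have s: "s \<in> {a..b}" "w s \<le> c" "\<And>t. t \<in> {a..b} \<Longrightarrow> w t \<le> c \<Longrightarrow> t \<le> s" by auto
  have "s \<noteq> b" using s(2) assms by auto
  then have sb: "s \<in> {a..<b}" using s(1) by auto
  have gt: "c < w t" if "t \<in> {s<..b}" for t using s(1) s(3)[of t] that by force
  obtain t where t: "s \<le> t" "t \<le> b" "w t = c"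
    using IVT'[of w s c b] s(1,2) assms continuous_on_subset[OF cont, of "{s..b}"] by auto
  then have "w s = c" using gt[of t] by (cases "t = s") auto
  then show ?thesis using sb gt by blast
qed

lemma first_time_at_level:
  fixes w :: "real \<Rightarrow> real"
  assumes cont: "continuous_on {a..b} w" and "a \<le> b" "c < w a" "w b \<le> c"
  shows "\<exists>s\<in>{a<..b}. w s = c \<and> (\<forall>t\<in>{a..<s}. c < w t)"
proof -
  have "continuous_on {- b..- a} (\<lambda>t. w (- t))"
    by (intro continuous_on_compose2[OF cont] continuous_intros) auto
  then obtain s where s: "s \<in> {- b..< - a}" "w (- s) = c" "\<forall>t\<in>{s<..- a}. c < w (- t)"
    using last_time_at_level[of "- b" "- a" "\<lambda>t. w (- t)" c] assms by auto
  have "c < w t" if "t \<in> {a..<- s}" for t using s(3)[rule_format, of "- t"] that by auto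
  then show ?thesis using s by (intro bexI[of _ "- s"]) auto
qed

lemma has_real_derivative_mono:
  fixes u :: "real \<Rightarrow> real"
  assumes "a \<le> b"
    and "\<And>t. t \<in> {a..b} \<Longrightarrow> (u has_real_derivative u' t) (at t within {a..b})"
    and "\<And>t. t \<in> {a..b} \<Longrightarrow> 0 \<le> u' t"
  shows "u a \<le> u b"
proof (cases "a = b")
  case False
  then have "a < b" using assms by auto
  then obtain z where "z \<in> {a<..<b}" and "u b - u a = (\<lambda>h. u' z * h) (b - a)"
    using mvt_simple[of a b u "\<lambda>t h. u' t * h"] assms(2)
    by (auto simp: has_field_derivative_def)
  moreover have "0 \<le> u' z * (b - a)" using assms(3)[of z] \<open>z \<in> _\<close> \<open>a < b\<close> by simp
  ultimately show ?thesis by simp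
qed simp

text \<open>After the last return \<open>s\<close> to the value \<open>u a\<close>, continuity keeps
  \<open>u\<close> above \<open>c\<close> for a while, so \<open>u\<close> cannot drop right after
  \<open>s\<close>. The sign of \<open>u'\<close> is assumed only above \<open>c\<close> because
  \<open>U'\<close> is controlled only where \<open>V \<ge> v0\<close>, which a high value of
  \<open>U\<close> guarantees.\<close>

lemma nondecreasing_above_level:
  fixes u :: "real \<Rightarrow> real"
  assumes "a \<le> b"
    and der: "\<And>t. t \<in> {a..b} \<Longrightarrow> (u has_real_derivative u' t) (at t within {a..b})"
    and nonneg: "\<And>t. t \<in> {a..b} \<Longrightarrow> c < u t \<Longrightarrow> 0 \<le> u' t"
    and "c < u a"
  shows "u a \<le> u b"
proof (rule ccontr)
  assume less: "\<not> u a \<le> u b"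
  have cont: "continuous_on {a..b} u"
    using der DERIV_continuous continuous_on_eq_continuous_within by blast
  obtain s where s: "s \<in> {a..<b}" "u s = u a" "\<And>t. t \<in> {s<..b} \<Longrightarrow> u t < u a"
    using last_time_at_level[of a b "\<lambda>t. - u t" "- u a"] less \<open>a \<le> b\<close> cont
    by (force intro: continuous_intros)
  have "(u \<longlongrightarrow> u s) (at s within {a..b})"
    using cont s(1) by (auto simp: continuous_on_def)
  then have "\<forall>\<^sub>F t in at s within {a..b}. c < u t"
    using order_tendstoD(1) s(2) \<open>c < u a\<close> by metis
  then obtain d where d: "d > 0" "\<And>t. t \<in> {a..b} \<Longrightarrow> t \<noteq> s \<Longrightarrow> dist t s < d \<Longrightarrow> c < u t"
    unfolding eventually_at by auto
  define t1 where "t1 = min b (s + d / 2)"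
  have t1: "t1 \<in> {s<..b}" using s(1) d(1) by (auto simp: t1_def)
  have "u s \<le> u t1"
  proof (rule has_real_derivative_mono[where a=s and b=t1 and u=u and u'=u'])
    fix t assume t: "t \<in> {s..t1}"
    then have tab: "t \<in> {a..b}" using s(1) t1 by auto
    then show "(u has_real_derivative u' t) (at t within {s..t1})"
      using der s(1) t1 by (intro DERIV_subset[OF der]) auto
    have "dist t s < d" using t d(1) by (auto simp: t1_def dist_real_def)
    then have "c < u t" using d(2)[OF tab] s(2) \<open>c < u a\<close> by (cases "t = s") auto
    then show "0 \<le> u' t" using nonneg tab by simp
  qed (use t1 in auto)
  then show False using s(2) s(3)[OF t1] by simp
qed

lemma compact_norm_bound:
  assumes "compact K" "continuous_on K h"
  shows "\<exists>c>0. \<forall>z\<in>K. norm (h z) \<le> c"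
  using compact_imp_bounded[OF compact_continuous_image[OF assms(2,1)]]
  unfolding bounded_pos by auto

text \<open>Abstractly, \<open>N\<close> and \<open>E\<close> are the rates \<open>2\<Gamma>(v) + \<xi>v\<close> and \<open>2\<Delta>(v) + \<sigma>v\<close>, \<open>g\<close> is an
  antiderivative of \<open>\<gamma>\<close>, and \<open>\<Lambda>\<close> and \<open>l\<close> are the extreme values of \<open>\<lambda>\<^sup>+\<close> and \<open>\<lambda>\<^sub>-\<close>.\<close>

locale guiding_pair =
  fixes sp :: "real^'n \<Rightarrow> real^'n \<Rightarrow> real"
    and S B S' B' :: "real \<Rightarrow> real^'n^'n"
    and Pp Pm :: "real \<Rightarrow> real^'n^'n"
    and Lp Lm :: "real \<Rightarrow> (real^'n) set"
    and f :: "real \<Rightarrow> real^'n \<Rightarrow> real^'n"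
    and \<gamma> g N E F :: "real \<Rightarrow> real"
    and lhi llo :: "real \<Rightarrow> real"
    and v0 \<Lambda> l k :: real
  assumes sp: "is_scalar_product sp"
    and S: "\<And>t. (S has_vector_derivative S' t) (at t)" "continuous_on UNIV S'"
      "\<And>t. symmetric_op sp (S t)" "\<And>t. invertible (S t)"
    and B: "\<And>t. (B has_vector_derivative B' t) (at t)"
      "\<And>t. symmetric_op sp (B t)" "\<And>t. pos_def_on sp UNIV (B t)"
    and decomp: "\<And>t. direct_sum_projectors (Pp t) (Pm t) (Lp t) (Lm t)"
      "\<And>t. pos_def_on sp (Lp t) (S t)" "\<And>t. neg_def_on sp (Lm t) (S t)"
    and f: "continuous_on UNIV (\<lambda>(t, x). f t x)" "ode_uniqueness f"
    and g: "\<And>t. (g has_real_derivative \<gamma> t) (at t)" "\<And>t. 0 < \<gamma> t"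
      "filterlim g at_top at_top" "filterlim g at_bot at_bot"
    and rate_S: "\<And>t x. v0 \<le> sp (B t *v x) x \<Longrightarrow>
        \<gamma> t * N (sp (B t *v x) x) \<le> 2 * sp (S t *v f t x) x + sp (S' t *v x) x"
    and rate_B: "\<And>t x. v0 \<le> sp (B t *v x) x \<Longrightarrow>
        \<bar>2 * sp (B t *v f t x) x + sp (B' t *v x) x\<bar> \<le> \<gamma> t * E (sp (B t *v x) x)"
    and N: "0 < k" "\<And>v. v0 \<le> v \<Longrightarrow> k \<le> N v"
    and E: "\<And>v. v0 \<le> v \<Longrightarrow> 0 < E v"
    and F: "F v0 = 0" "\<And>v. v0 \<le> v \<Longrightarrow> (F has_real_derivative N v / E v) (at v within {v0..})"
      "filterlim F at_top at_top"
    and v0: "0 < v0"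
    and pencil: "\<And>t x. sp (S t *v x) x \<le> lhi t * sp (B t *v x) x"
      "\<And>t x. llo t * sp (B t *v x) x \<le> sp (S t *v x) x"
      "\<And>t. 0 < lhi t" "\<And>t. llo t < 0" "\<And>t. lhi t \<le> \<Lambda>" "\<And>t. l \<le> llo t"
begin

section \<open>The two forms along solutions\<close>

definition U where "U t x = sp (S t *v x) x"
definition V where "V t x = sp (B t *v x) x"

lemma cont_S: "continuous_on X S" and cont_B: "continuous_on X B"
  by (intro continuous_at_imp_continuous_on ballI has_vector_derivative_continuous[OF S(1)])
    (intro continuous_at_imp_continuous_on ballI has_vector_derivative_continuous[OF B(1)])

lemma cont_U: "continuous_on X (\<lambda>(t, x). U t x)" and cont_V: "continuous_on X (\<lambda>(t, x). V t x)"
  using continuous_on_subset[OF continuous_on_form[OF sp cont_S, of UNIV UNIV], of X]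
    continuous_on_subset[OF continuous_on_form[OF sp cont_B, of UNIV UNIV], of X]
  unfolding U_def V_def by simp_all

lemma V_nonneg: "0 \<le> V t x"
  using B(3)[of t] unfolding V_def pos_def_on_def by (cases "x = 0") (auto simp: sp_algebra[OF sp] less_imp_le)

lemma U_le: "U t x \<le> \<Lambda> * V t x" and U_ge: "l * V t x \<le> U t x"
  using pencil(1)[of t x] pencil(2)[of t x] V_nonneg[of t x]
    mult_right_mono[OF pencil(5)[of t], of "V t x"] mult_right_mono[OF pencil(6)[of t], of "V t x"]
  unfolding U_def V_def by linarith+

lemma \<Lambda>_pos: "0 < \<Lambda>" and l_neg: "l < 0"
  using pencil(3,5)[of 0] pencil(4,6)[of 0] by linarith+

lemma U_deriv:
  assumes "(x has_vector_derivative x') (at t within I)"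
  shows "((\<lambda>t. U t (x t)) has_real_derivative 2 * sp (S t *v x') (x t) + sp (S' t *v x t) (x t)) (at t within I)"
  unfolding U_def
  by (rule has_real_derivative_form[OF sp S(3) has_vector_derivative_at_within[OF S(1)] assms])

lemma V_deriv:
  assumes "(x has_vector_derivative x') (at t within I)"
  shows "((\<lambda>t. V t (x t)) has_real_derivative 2 * sp (B t *v x') (x t) + sp (B' t *v x t) (x t)) (at t within I)"
  unfolding V_def
  by (rule has_real_derivative_form[OF sp B(2) has_vector_derivative_at_within[OF B(1)] assms])

lemma cont_along:
  assumes "continuous_on I x"
  shows "continuous_on I (\<lambda>t. U t (x t))" "continuous_on I (\<lambda>t. V t (x t))"
proof -
  have "continuous_on I (\<lambda>t. (t, x t))" by (intro continuous_intros assms)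
  then show "continuous_on I (\<lambda>t. U t (x t))" "continuous_on I (\<lambda>t. V t (x t))"
    using continuous_on_compose2[OF cont_U[of UNIV], of I "\<lambda>t. (t, x t)"]
      continuous_on_compose2[OF cont_V[of UNIV], of I "\<lambda>t. (t, x t)"] by simp_all
qed

lemma solution_cont:
  assumes "\<And>t. t \<in> I \<Longrightarrow> (x has_vector_derivative x' t) (at t within I)"
  shows "continuous_on I x"
  unfolding continuous_on_eq_continuous_within
  by (intro ballI has_vector_derivative_continuous[OF assms])

lemma F_mono: "v0 \<le> a \<Longrightarrow> a < b \<Longrightarrow> F a < F b"
proof -
  assume ab: "v0 \<le> a" "a < b"
  have der: "(F has_derivative (*) (N v / E v)) (at v within {a..b})" if "a \<le> v" "v \<le> b" for v
    unfolding has_field_derivative_def[symmetric]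
    using that ab by (intro DERIV_subset[OF F(2)]) auto
  obtain z where z: "z \<in> {a<..<b}" "F b - F a = (\<lambda>h. N z / E z * h) (b - a)"
    using mvt_simple[OF ab(2) der] by blast
  have "0 < N z / E z" using N(1) N(2)[of z] E[of z] z(1) ab by auto
  then have "0 < N z / E z * (b - a)" using ab by (intro mult_pos_pos) auto
  then show ?thesis using z(2) by simp
qed

lemma F_nonneg: "v0 \<le> v \<Longrightarrow> 0 \<le> F v"
  using F_mono[of v0 v] F(1) by (cases "v = v0") auto

lemma F_unbounded: "\<exists>v>c. v0 < v \<and> b < F v"
proof -
  have "\<forall>\<^sub>F v in at_top. b < F v" using F(3) by (simp add: filterlim_at_top_dense)
  moreover have "\<forall>\<^sub>F v in at_top. max c v0 < v" by (rule eventually_gt_at_top)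
  ultimately have "\<forall>\<^sub>F v in at_top. max c v0 < v \<and> b < F v" by eventually_elim auto
  then show ?thesis using eventually_happens'[OF trivial_limit_at_top_linorder] by fastforce
qed

text \<open>The derivative of \<open>F(V)\<close> has modulus at most
  \<open>(N / E) * \<gamma> * E = \<gamma> * N\<close>, which \<open>U'\<close> dominates; so
  \<open>U - F(V)\<close> and \<open>U + F(V)\<close> are both nondecreasing.\<close>

lemma F_V_le_U:
  assumes sol: "\<And>t. t \<in> {a..b} \<Longrightarrow> (x has_vector_derivative f t (x t)) (at t within {a..b})"
    and V: "\<And>t. t \<in> {a..b} \<Longrightarrow> v0 \<le> V t (x t)" and "a \<le> b"
  shows "F (V b (x b)) - F (V a (x a)) \<le> U b (x b) - U a (x a)"
    and "F (V a (x a)) - F (V b (x b)) \<le> U b (x b) - U a (x a)"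
proof -
  let ?v = "\<lambda>t. V t (x t)" and ?u = "\<lambda>t. U t (x t)"
  let ?u' = "\<lambda>t. 2 * sp (S t *v f t (x t)) (x t) + sp (S' t *v x t) (x t)"
  let ?v' = "\<lambda>t. 2 * sp (B t *v f t (x t)) (x t) + sp (B' t *v x t) (x t)"
  have u: "(?u has_real_derivative ?u' t) (at t within {a..b})" if "t \<in> {a..b}" for t
    using U_deriv[OF sol[OF that]] .
  have Fv: "((\<lambda>t. F (?v t)) has_real_derivative N (?v t) / E (?v t) * ?v' t) (at t within {a..b})"
    if "t \<in> {a..b}" for t
  proof -
    have "?v ` {a..b} \<subseteq> {v0..}" using V by auto
    from DERIV_subset[OF F(2)[OF V[OF that]] this] show ?thesis
      by (rule DERIV_image_chain[OF _ V_deriv[OF sol[OF that]], unfolded o_def])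
  qed
  have le: "\<bar>N (?v t) / E (?v t) * ?v' t\<bar> \<le> ?u' t" if "t \<in> {a..b}" for t
  proof -
    have N0: "0 \<le> N (?v t)" and E0: "0 < E (?v t)" using N E V[OF that] by (force, blast)
    then have "\<bar>N (?v t) / E (?v t) * ?v' t\<bar> = N (?v t) / E (?v t) * \<bar>?v' t\<bar>"
      by (simp add: abs_mult)
    also have "\<dots> \<le> N (?v t) / E (?v t) * (\<gamma> t * E (?v t))"
      using N0 E0 rate_B[of t "x t"] V[OF that] unfolding V_def by (intro mult_left_mono) auto
    also have "\<dots> = \<gamma> t * N (?v t)" using E0 by simp
    also have "\<dots> \<le> ?u' t" using rate_S[of t "x t"] V[OF that] unfolding V_def by simp
    finally show ?thesis .
  qed
  have "(\<lambda>t. ?u t - F (?v t)) a \<le> (\<lambda>t. ?u t - F (?v t)) b"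
  proof (rule has_real_derivative_mono[OF \<open>a \<le> b\<close> DERIV_diff[OF u Fv]])
    show "0 \<le> ?u' t - N (?v t) / E (?v t) * ?v' t" if "t \<in> {a..b}" for t
      using le[OF that] by linarith
  qed
  then show "F (V b (x b)) - F (V a (x a)) \<le> U b (x b) - U a (x a)" by simp
  have "(\<lambda>t. ?u t + F (?v t)) a \<le> (\<lambda>t. ?u t + F (?v t)) b"
  proof (rule has_real_derivative_mono[OF \<open>a \<le> b\<close> DERIV_add[OF u Fv]])
    show "0 \<le> ?u' t + N (?v t) / E (?v t) * ?v' t" if "t \<in> {a..b}" for t
      using le[OF that] by linarith
  qed
  then show "F (V a (x a)) - F (V b (x b)) \<le> U b (x b) - U a (x a)" by simp
qed

text \<open>The linear field \<open>x \<mapsto> G t x\<close> leaves \<open>U\<close> invariant; the vector field is cut off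
  to it where \<open>V\<close> is large, which keeps \<open>U\<close> monotone and prevents blow-up.\<close>

definition G where "G t = - (1/2) *\<^sub>R (matrix_inv (S t) ** S' t)"

lemma cont_G: "continuous_on X G"
proof -
  have "continuous_on X (\<lambda>t. matrix_inv (S t))" by (intro continuous_on_matrix_inv cont_S S(4))
  moreover have "continuous_on X S'" using S(2) continuous_on_subset by blast
  ultimately have "continuous_on X (\<lambda>t. matrix_inv (S t) ** S' t)"
    by (rule bounded_bilinear.continuous_on[OF bounded_bilinear_matrix_matrix])
  then show ?thesis unfolding G_def by (intro continuous_on_scaleR continuous_on_const)
qed

lemma S_G: "S t *v (G t *v x) = - (1/2) *\<^sub>R (S' t *v x)"
proof -
  have "S t ** (matrix_inv (S t) ** S' t) = S' t"
    by (simp add: matrix_mul_assoc matrix_inv_mult S(4))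
  then show ?thesis
    unfolding G_def by (simp add: matvec_algebra matrix_vector_mul_assoc)
qed

lemma sp_S_G: "2 * sp (S t *v (G t *v x)) x + sp (S' t *v x) x = 0"
  by (simp add: S_G sp_algebra[OF sp])

section \<open>The truncated vector field\<close>

text \<open>A pointwise convex combination: it is \<open>f\<close> for \<open>V \<le> C\<close> and
  the linear field for \<open>V \<ge> C + 1\<close>. Since \<open>U'\<close> depends affinely on the
  field, its sign passes from the two ingredients to the mixture.\<close>

definition cutoff where
  "cutoff C t x = (let c = max 0 (min 1 (C + 1 - V t x)) in c *\<^sub>R f t x + (1 - c) *\<^sub>R (G t *v x))"

lemma cutoff_eq: "V t x \<le> C \<Longrightarrow> cutoff C t x = f t x"
  by (simp add: cutoff_def Let_def)

lemma cont_cutoff: "continuous_on UNIV (\<lambda>(t, x). cutoff C t x)"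
proof -
  have "continuous_on UNIV (\<lambda>z. G (fst z))"
    by (rule continuous_on_compose2[OF cont_G[of UNIV] continuous_on_fst[OF continuous_on_id]]) simp
  then show ?thesis
    using cont_V[of UNIV] f(1) unfolding cutoff_def Let_def split_def
    by (intro continuous_intros)
qed

lemma cutoff_U:
  assumes "v0 \<le> V t x"
  shows "0 \<le> 2 * sp (S t *v cutoff C t x) x + sp (S' t *v x) x"
proof -
  define c where "c = max 0 (min 1 (C + 1 - V t x))"
  have c: "0 \<le> c" "c \<le> 1" by (auto simp: c_def)
  have "0 \<le> \<gamma> t * N (V t x)" using g(2)[of t] N N(2)[OF assms] by (intro mult_nonneg_nonneg) auto
  then have "0 \<le> 2 * sp (S t *v f t x) x + sp (S' t *v x) x"
    using rate_S[of t x] assms unfolding V_def by linarith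
  then have "0 \<le> c * (2 * sp (S t *v f t x) x + sp (S' t *v x) x)
     + (1 - c) * (2 * sp (S t *v (G t *v x)) x + sp (S' t *v x) x)"
    using c unfolding sp_S_G by simp
  also have "\<dots> = 2 * sp (S t *v cutoff C t x) x + sp (S' t *v x) x"
    unfolding cutoff_def Let_def c_def[symmetric]
    by (simp add: sp_algebra[OF sp] matvec_algebra algebra_simps)
  finally show ?thesis .
qed

lemma V_coercive: "\<exists>m>0. \<forall>t\<in>{a..b}. \<forall>x. m * (norm x)\<^sup>2 \<le> V t x"
  unfolding V_def by (rule form_coercive[OF sp cont_B B(3)])

lemma V_bounded_imp_bounded: "\<exists>R. \<forall>t\<in>{a..b}. \<forall>x. V t x \<le> C \<longrightarrow> norm x \<le> R"
proof -
  obtain m where m: "m > 0" "\<And>t x. t \<in> {a..b} \<Longrightarrow> m * (norm x)\<^sup>2 \<le> V t x"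
    using V_coercive by blast
  have "norm x \<le> sqrt (C / m)" if "t \<in> {a..b}" "V t x \<le> C" for t x
  proof (rule real_le_rsqrt)
    have "m * (norm x)\<^sup>2 \<le> C" using m(2)[OF that(1), of x] that(2) by simp
    then show "(norm x)\<^sup>2 \<le> C / m" using m(1) by (simp add: field_simps)
  qed
  then show ?thesis by blast
qed

text \<open>\<open>f\<close> contributes only where \<open>V \<le> C + 1\<close>, a bounded region
  over a compact time interval; the other contribution is at most linear in
  \<open>x\<close>.\<close>

lemma cutoff_growth:
  "\<exists>K\<ge>0. \<forall>t\<in>{a..b}. \<forall>x. norm (cutoff C t x) \<le> K * (1 + norm x)"
proof -
  obtain R where R: "\<And>t x. t \<in> {a..b} \<Longrightarrow> V t x \<le> C + 1 \<Longrightarrow> norm x \<le> R"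
    using V_bounded_imp_bounded[of a b "C + 1"] by blast
  have "\<exists>c>0. \<forall>z\<in>{a..b} \<times> cball 0 R. norm ((\<lambda>(t, x). f t x) z) \<le> c"
    by (intro compact_norm_bound compact_Times continuous_on_subset[OF f(1)]) auto
  then obtain K1 where "0 < K1" "\<forall>z\<in>{a..b} \<times> cball 0 R. norm ((\<lambda>(t, x). f t x) z) \<le> K1" by blast
  then have K1: "0 < K1" "\<And>t x. t \<in> {a..b} \<Longrightarrow> norm x \<le> R \<Longrightarrow> norm (f t x) \<le> K1" by auto
  obtain K2 where K2: "0 < K2" "\<And>t. t \<in> {a..b} \<Longrightarrow> norm (G t) \<le> K2"
    using compact_norm_bound[OF compact_Icc cont_G] by metis
  obtain K3 where K3: "0 < K3" "\<And>(A::real^'n^'n) (x::real^'n). norm (A *v x) \<le> norm A * norm x * K3"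
    using bounded_bilinear.pos_bounded[OF bounded_bilinear_matrix_vector] by blast
  have "norm (cutoff C t x) \<le> (K1 + K2 * K3) * (1 + norm x)" if t: "t \<in> {a..b}" for t x
  proof -
    define c where "c = max 0 (min 1 (C + 1 - V t x))"
    have c: "0 \<le> c" "c \<le> 1" by (auto simp: c_def)
    have 1: "norm (c *\<^sub>R f t x) \<le> K1"
    proof (cases "V t x \<le> C + 1")
      case True
      then have "norm (f t x) \<le> K1" using K1 R t by blast
      then have "c * norm (f t x) \<le> 1 * K1" using c K1(1) by (intro mult_mono) auto
      then show ?thesis using c by simp
    next
      case False
      then have "c = 0" by (simp add: c_def)
      then show ?thesis using K1(1) by simp
    qed
    have "norm (G t *v x) \<le> K2 * norm x * K3"
      using K2 K3(1) t by (intro order.trans[OF K3(2)] mult_right_mono) auto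
    then have "(1 - c) * norm (G t *v x) \<le> 1 * (K2 * norm x * K3)"
      using c K2(1) K3(1) by (intro mult_mono) auto
    then have 2: "norm ((1 - c) *\<^sub>R (G t *v x)) \<le> K2 * norm x * K3" using c by simp
    have "norm (cutoff C t x) \<le> K1 + K2 * norm x * K3"
      unfolding cutoff_def Let_def c_def[symmetric] using 1 2 by (intro norm_triangle_mono)
    also have "\<dots> \<le> (K1 + K2 * K3) * (1 + norm x)"
      using K1(1) K2(1) K3(1) by (simp add: algebra_simps)
    finally show ?thesis .
  qed
  then show ?thesis using K1(1) K2(1) K3(1) by (intro exI[of _ "K1 + K2 * K3"]) auto
qed

section \<open>A priori estimates for the truncated equation on a compact interval\<close>

context
  fixes C0 C1 a b :: real and y
  assumes C0: "v0 < C0" "v0 * \<Lambda> \<le> F C0"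
    and C1: "C0 < C1" "F C0 + v0 * \<Lambda> - l * C0 < F C1"
    and ab: "a < b"
    and y: "\<And>t. t \<in> {a..b} \<Longrightarrow> (y has_vector_derivative cutoff C1 t (y t)) (at t within {a..b})"
begin

lemma y_sub:
  assumes "a \<le> s" "t \<le> b" "\<tau> \<in> {s..t}"
  shows "(y has_vector_derivative cutoff C1 \<tau> (y \<tau>)) (at \<tau> within {s..t})"
  using assms by (intro has_vector_derivative_within_subset[OF y]) auto

lemma cont_UV: "a \<le> s \<Longrightarrow> t \<le> b \<Longrightarrow> continuous_on {s..t} (\<lambda>t. U t (y t))"
  "a \<le> s \<Longrightarrow> t \<le> b \<Longrightarrow> continuous_on {s..t} (\<lambda>t. V t (y t))"
proof -
  have "continuous_on {a..b} y" by (rule solution_cont[OF y])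
  then have "continuous_on {s..t} y" if "a \<le> s" "t \<le> b"
    using that by (auto intro: continuous_on_subset)
  then show "a \<le> s \<Longrightarrow> t \<le> b \<Longrightarrow> continuous_on {s..t} (\<lambda>t. U t (y t))"
    "a \<le> s \<Longrightarrow> t \<le> b \<Longrightarrow> continuous_on {s..t} (\<lambda>t. V t (y t))"
    by (intro cont_along; simp)+
qed

lemma U_mono:
  assumes "a \<le> s" "s \<le> t" "t \<le> b" "\<And>\<tau>. \<tau> \<in> {s..t} \<Longrightarrow> v0 \<le> V \<tau> (y \<tau>)"
  shows "U s (y s) \<le> U t (y t)"
proof (rule has_real_derivative_mono[OF assms(2), where u="\<lambda>t. U t (y t)"])
  fix \<tau> assume \<tau>: "\<tau> \<in> {s..t}"
  show "((\<lambda>t. U t (y t)) has_real_derivative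
      2 * sp (S \<tau> *v cutoff C1 \<tau> (y \<tau>)) (y \<tau>) + sp (S' \<tau> *v y \<tau>) (y \<tau>)) (at \<tau> within {s..t})"
    by (rule U_deriv[OF y_sub[OF assms(1,3) \<tau>]])
  show "0 \<le> 2 * sp (S \<tau> *v cutoff C1 \<tau> (y \<tau>)) (y \<tau>) + sp (S' \<tau> *v y \<tau>) (y \<tau>)"
    by (rule cutoff_U[OF assms(4)[OF \<tau>]])
qed

text \<open>As long as \<open>V \<ge> v0\<close>, \<open>U\<close> does not decrease, so losing
  positivity requires a visit to the level \<open>v0\<close>. The descent from \<open>C0\<close> to
  the first such visit raises \<open>U\<close> by at least \<open>F C0 \<ge> v0 * \<Lambda>\<close>
  from a positive value, against \<open>U \<le> \<Lambda> * V = \<Lambda> * v0\<close>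
  there.\<close>

lemma U_pos_from_boundary:
  assumes Va: "V a (y a) = C0" and Ua: "0 < U a (y a)" and t: "t \<in> {a..b}"
  shows "0 < U t (y t)"
proof (rule ccontr)
  assume neg: "\<not> 0 < U t (y t)"
  have "\<exists>\<tau>\<in>{a..t}. V \<tau> (y \<tau>) \<le> v0"
  proof (rule ccontr)
    assume "\<not> ?thesis"
    then have "v0 \<le> V \<tau> (y \<tau>)" if "\<tau> \<in> {a..t}" for \<tau> using that by force
    then have "U a (y a) \<le> U t (y t)" using t by (intro U_mono) auto
    then show False using neg Ua by simp
  qed
  then obtain \<tau> where \<tau>: "\<tau> \<in> {a..t}" "V \<tau> (y \<tau>) \<le> v0" by blast
  then obtain e where e: "e \<in> {a<..\<tau>}" "V e (y e) = v0" "\<forall>t\<in>{a..<e}. v0 < V t (y t)"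
    using first_time_at_level[of a \<tau> "\<lambda>t. V t (y t)" v0] cont_UV(2)[of a \<tau>] Va C0 t by auto
  have v0_le: "v0 \<le> V t (y t)" if "t \<in> {a..e}" for t
    using e(2,3) that by (cases "t = e") (auto intro: less_imp_le)
  \<comment> \<open>After the last time at level \<open>C0\<close> one has
    \<open>V \<le> C0 < C1\<close>, so the truncation is inactive and \<open>F_V_le_U\<close>
    applies; before it, monotonicity of \<open>U\<close> is enough.\<close>
  obtain s where s: "s \<in> {a..<e}" "V s (y s) = C0" "\<forall>t\<in>{s<..e}. V t (y t) < C0"
    using last_time_at_level[of a e "\<lambda>t. - V t (y t)" "- C0"] cont_UV(2)[of a e] Va C0 t e \<tau>
    by (force intro: continuous_intros)
  have "(y has_vector_derivative f \<theta> (y \<theta>)) (at \<theta> within {s..e})" if \<theta>: "\<theta> \<in> {s..e}" for \<theta>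
  proof -
    have "V \<theta> (y \<theta>) \<le> C1" using s(2) s(3)[rule_format, of \<theta>] \<theta> C1(1) by (cases "\<theta> = s") auto
    moreover have "e \<le> b" "a \<le> s" using s(1) e(1) \<tau>(1) t by auto
    ultimately show ?thesis using y_sub[of s e \<theta>] \<theta> cutoff_eq[of \<theta> "y \<theta>" C1] by simp
  qed
  then have "F (V s (y s)) - F (V e (y e)) \<le> U e (y e) - U s (y s)"
    using s(1) v0_le by (intro F_V_le_U) auto
  moreover have "U a (y a) \<le> U s (y s)" using s(1) v0_le e(1) \<tau>(1) t by (intro U_mono) auto
  ultimately have "v0 * \<Lambda> < U e (y e)" using s(2) e(2) F(1) Ua C0 by simp
  then show False using U_le[of e "y e"] e(2) by (simp add: mult.commute)
qed

text \<open>Reaching \<open>C1\<close> requires a climb from \<open>C0\<close>, which takes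
  \<open>U\<close> from at least \<open>l * C0\<close> past \<open>v0 * \<Lambda>\<close>. Above
  that value \<open>U \<le> \<Lambda> * V\<close> forces \<open>V > v0\<close>, so \<open>U\<close>
  cannot come down again to a nonpositive value at \<open>b\<close>, even where the truncation
  acts.\<close>

lemma V_bound_interior:
  assumes Va: "V a (y a) \<le> C0" and Ub: "U b (y b) \<le> 0" and t: "t \<in> {a..b}"
  shows "V t (y t) < C1"
proof (rule ccontr)
  assume "\<not> V t (y t) < C1"
  then obtain e where e: "e \<in> {a<..t}" "V e (y e) = C1" "\<forall>t\<in>{a..<e}. V t (y t) < C1"
    using first_time_at_level[of a t "\<lambda>t. - V t (y t)" "- C1"] cont_UV(2)[of a t] Va C1 t
    by (force intro: continuous_intros)
  obtain s where s: "s \<in> {a..<e}" "V s (y s) = C0" "\<forall>t\<in>{s<..e}. C0 < V t (y t)"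
    using last_time_at_level[of a e "\<lambda>t. V t (y t)" C0] cont_UV(2)[of a e] Va C1 t e by force
  have *: "C0 \<le> V \<theta> (y \<theta>) \<and> V \<theta> (y \<theta>) \<le> C1" if \<theta>: "\<theta> \<in> {s..e}" for \<theta>
  proof
    show "C0 \<le> V \<theta> (y \<theta>)" using s(2) s(3)[rule_format, of \<theta>] \<theta> by (cases "\<theta> = s") auto
    show "V \<theta> (y \<theta>) \<le> C1" using e(2) e(3)[rule_format, of \<theta>] \<theta> s(1) by (cases "\<theta> = e") auto
  qed
  have "(y has_vector_derivative f \<tau> (y \<tau>)) (at \<tau> within {s..e})" if "\<tau> \<in> {s..e}" for \<tau>
    using y_sub[of s e \<tau>] that s(1) e(1) t cutoff_eq[of \<tau> "y \<tau>" C1] *[OF that] by auto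
  then have "F (V e (y e)) - F (V s (y s)) \<le> U e (y e) - U s (y s)"
    using s(1) * C0(1) by (intro F_V_le_U) force+
  moreover have "l * C0 \<le> U s (y s)" using U_ge[of s "y s"] s(2) by simp
  ultimately have gt: "v0 * \<Lambda> < U e (y e)" using C1(2) s(2) e(2) by simp
  have "U e (y e) \<le> U b (y b)"
  proof (rule nondecreasing_above_level[where u="\<lambda>t. U t (y t)", OF _ _ _ gt])
    fix \<tau> assume \<tau>: "\<tau> \<in> {e..b}"
    show "((\<lambda>t. U t (y t)) has_real_derivative
        2 * sp (S \<tau> *v cutoff C1 \<tau> (y \<tau>)) (y \<tau>) + sp (S' \<tau> *v y \<tau>) (y \<tau>)) (at \<tau> within {e..b})"
      using e(1) by (intro U_deriv y_sub \<tau>) auto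
    assume "v0 * \<Lambda> < U \<tau> (y \<tau>)"
    then have "\<Lambda> * v0 < \<Lambda> * V \<tau> (y \<tau>)" using U_le[of \<tau> "y \<tau>"] by (simp add: mult.commute)
    then show "0 \<le> 2 * sp (S \<tau> *v cutoff C1 \<tau> (y \<tau>)) (y \<tau>) + sp (S' \<tau> *v y \<tau>) (y \<tau>)"
      using \<Lambda>_pos by (intro cutoff_U) simp
  qed (use e t in auto)
  then show False using gt Ub v0 \<Lambda>_pos mult_pos_pos[OF v0 \<Lambda>_pos] by simp
qed

end

text \<open>The flow \<open>C' = G C\<close> makes \<open>U t (C t *v z)\<close> constant, and
  \<open>D' = - D G\<close> is the equation of its inverse: \<open>D C\<close> has zero derivative,
  so it stays \<open>mat 1\<close>. Solving both equations yields the inverse together with its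
  continuity.\<close>

lemma congruence_path:
  assumes "a < b"
  obtains D where "continuous_on {a..b} D" "D a = mat 1"
    "\<And>t x. t \<in> {a..b} \<Longrightarrow> U a (D t *v x) = U t x"
proof -
  obtain K2 where K2: "0 < K2" "\<And>t. t \<in> {a..b} \<Longrightarrow> norm (G t) \<le> K2"
    using compact_norm_bound[OF compact_Icc cont_G] by metis
  obtain K3 where K3: "0 < K3" "\<And>(A::real^'n^'n) (X::real^'n^'n). norm (A ** X) \<le> norm A * norm X * K3"
    using bounded_bilinear.pos_bounded[OF bounded_bilinear_matrix_matrix] by blast
  have b1: "norm (G t ** X) \<le> K2 * K3 * (1 + norm X)"
    and b2: "norm (- (X ** G t)) \<le> K2 * K3 * (1 + norm X)" if t: "t \<in> {a..b}" for t X
  proof -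
    have "norm (G t) * norm X * K3 \<le> K2 * norm X * K3"
      using K2 K3(1) t by (intro mult_right_mono) auto
    also have "\<dots> \<le> K2 * K3 * (1 + norm X)" using K2(1) K3(1) by (simp add: algebra_simps)
    finally have *: "norm (G t) * norm X * K3 \<le> K2 * K3 * (1 + norm X)" .
    show "norm (G t ** X) \<le> K2 * K3 * (1 + norm X)" using K3(2)[of "G t" X] * by linarith
    have "norm (- (X ** G t)) = norm (X ** G t)" by (rule norm_minus_cancel)
    also have "\<dots> \<le> norm X * norm (G t) * K3" by (rule K3(2))
    also have "\<dots> = norm (G t) * norm X * K3" by simp
    finally show "norm (- (X ** G t)) \<le> K2 * K3 * (1 + norm X)" using * by linarith
  qed
  have K: "0 \<le> K2 * K3" using K2(1) K3(1) by simp
  have c1: "continuous_on UNIV (\<lambda>(t, X::real^'n^'n). G t ** X)" 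
    and c2: "continuous_on UNIV (\<lambda>(t, X::real^'n^'n). - (X ** G t))"
    unfolding split_def
    by (intro continuous_intros continuous_on_compose2[OF cont_G[of UNIV]] 
      bounded_bilinear.continuous_on[OF bounded_bilinear_matrix_matrix]; simp)+
  obtain C where C: "C a = mat 1" "continuous_on {a..b} C"
    "\<And>t. t \<in> {a..b} \<Longrightarrow> (C has_vector_derivative G t ** C t) (at t within {a..b})"
    using peano_linear_growth[OF \<open>a < b\<close> c1 K b1] by blast
  obtain D where D: "D a = mat 1" "continuous_on {a..b} D"
    "\<And>t. t \<in> {a..b} \<Longrightarrow> (D has_vector_derivative - (D t ** G t)) (at t within {a..b})"
    using peano_linear_growth[OF \<open>a < b\<close> c2 K b2] by blast
  have "((\<lambda>t. D t ** C t) has_vector_derivative 0) (at t within {a..b})" if "t \<in> {a..b}" for t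
    using bounded_bilinear.has_vector_derivative[OF bounded_bilinear_matrix_matrix D(3)[OF that] C(3)[OF that]]
    by (simp add: matrix_mul_assoc bounded_bilinear.minus_left[OF bounded_bilinear_matrix_matrix])
  then obtain c where "\<And>t. t \<in> {a..b} \<Longrightarrow> D t ** C t = c"
    using has_vector_derivative_zero_constant[of "{a..b}" "\<lambda>t. D t ** C t"] by auto
  then have "D t ** C t = mat 1" if "t \<in> {a..b}" for t
    using that C(1) D(1) \<open>a < b\<close> by (metis atLeastAtMost_iff less_imp_le matrix_mul_lid order_refl)
  then have CD: "C t ** D t = mat 1" if "t \<in> {a..b}" for t
    using that by (simp add: matrix_left_right_inverse)
  have "U a (D t *v x) = U t x" if t: "t \<in> {a..b}" for t x
  proof -
    define z where "z = D t *v x"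
    have "((\<lambda>t. U t (C t *v z)) has_real_derivative 0) (at \<tau> within {a..b})" if "\<tau> \<in> {a..b}" for \<tau>
    proof -
      have "((\<lambda>t. C t *v z) has_vector_derivative G \<tau> *v (C \<tau> *v z)) (at \<tau> within {a..b})"
        using bounded_bilinear.has_vector_derivative[OF bounded_bilinear_matrix_vector C(3)[OF that] has_vector_derivative_const[of z]]
        by (simp add: matrix_vector_mul_assoc matvec_algebra)
      from U_deriv[OF this] show ?thesis unfolding sp_S_G .
    qed
    then have "\<exists>c. \<forall>\<tau>\<in>{a..b}. U \<tau> (C \<tau> *v z) = c"
      by (intro has_field_derivative_zero_constant) auto
    then have "U a (C a *v z) = U t (C t *v z)" using t \<open>a < b\<close> by auto
    then show ?thesis using C(1) CD[OF t] by (simp add: z_def matrix_vector_mul_assoc)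
  qed
  with that D(1,2) show ?thesis by blast
qed

end

section \<open>Existence of a bounded solution\<close>

context guiding_pair
begin

lemma exists_on_interval:
  assumes C0: "v0 < C0" "v0 * \<Lambda> \<le> F C0"
    and C1: "C0 < C1" "F C0 + v0 * \<Lambda> - l * C0 < F C1"
    and ab: "a < b"
  shows "\<exists>y. \<forall>t\<in>{a..b}. (y has_vector_derivative f t (y t)) (at t within {a..b}) \<and> V t (y t) \<le> C1"
proof -
  \<comment> \<open>\<open>\<beta> x x\<close> is \<open>V a x\<close>, so the boundary in
    \<open>homotopy_zero\<close> is the level \<open>V a x = C0\<close>.\<close>
  define \<beta> where "\<beta> = (\<lambda>x y. sp (B a *v x) y)"
  define L where "L = Lp a"
  define \<Phi> where "\<Phi> = (\<lambda>k. euler (cutoff C1) a ((b - a) / Suc k) (Suc k))"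
  have \<beta>V: "\<beta> x x = V a x" for x by (simp add: \<beta>_def V_def)
  have "bilinear \<beta>"
    unfolding bilinear_def linear_iff \<beta>_def by (simp add: matvec_algebra sp_algebra[OF sp])
  moreover have "\<beta> x y = \<beta> y x" for x y
    using B(2)[of a] sp_sym[OF sp] unfolding \<beta>_def symmetric_op_def by metis
  ultimately have \<beta>: "is_scalar_product \<beta>"
    using B(3)[of a] unfolding is_scalar_product_def \<beta>_def pos_def_on_def by simp
  have L: "subspace L" and split: "\<exists>y\<in>L. \<exists>z\<in>Lm a. x = y + z"
    and P: "y \<in> L \<Longrightarrow> Pp a *v y = y" "z \<in> Lm a \<Longrightarrow> Pp a *v z = 0" for x y z
    using decomp(1)[of a] unfolding direct_sum_projectors_def L_def by blast+
  have PL: "Pp a *v x \<in> L" for x using split[of x] P by (auto simp: matvec_algebra)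
  have ker: "U a x \<le> 0" if "Pp a *v x = 0" for x
  proof -
    have "x \<in> Lm a" using split[of x] P that by (auto simp: matvec_algebra)
    then show ?thesis using decomp(3)[of a] unfolding U_def neg_def_on_def
      by (cases "x = 0") (auto simp: sp_algebra[OF sp] less_imp_le)
  qed
  obtain D where D: "continuous_on {a..b} D" "D a = mat 1"
    "\<And>t x. t \<in> {a..b} \<Longrightarrow> U a (D t *v x) = U t x"
    by (rule congruence_path[OF ab]) blast
  have h: "0 < (b - a) / Suc k" for k using ab by simp
  have cont\<Phi>: "continuous_on UNIV (\<lambda>(t, x). \<Phi> k t x)" for k
    unfolding \<Phi>_def by (intro continuous_on_euler cont_cutoff)
  have start\<Phi>: "\<Phi> k a x = x" for k x unfolding \<Phi>_def by (rule euler_start[OF h])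
  \<comment> \<open>A zero of the projected map puts \<open>D t *v \<Phi> k t x\<close> into
    \<open>Lm a\<close>, where \<open>U a \<le> 0\<close>; by the congruence,
    \<open>U t \<le> 0\<close> at the polygon itself.\<close>
  have "\<exists>t\<in>{a..b}. \<exists>x\<in>L. \<beta> x x \<le> C0 \<and> (t = b \<or> \<beta> x x = C0) \<and> Pp a *v (D t *v \<Phi> k t x) = 0" for k
  proof (rule homotopy_zero[OF \<beta> L])
    show "0 < C0" "a \<le> b" using C0 v0 ab by auto
    have "continuous_on ({a..b} \<times> {x \<in> L. \<beta> x x \<le> C0}) (\<lambda>z. D (fst z))"
      by (rule continuous_on_compose2[OF D(1) continuous_on_fst[OF continuous_on_id]]) auto
    then show "continuous_on ({a..b} \<times> {x \<in> L. \<beta> x x \<le> C0}) (\<lambda>(t, x). Pp a *v (D t *v \<Phi> k t x))"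
      using continuous_on_subset[OF cont\<Phi>[of k]] unfolding split_def
      by (intro continuous_intros) auto
  qed (use PL P(1) start\<Phi> D(2) in auto)
  then have "\<forall>k. \<exists>p. fst p \<in> {a..b} \<and> snd p \<in> L \<and> V a (snd p) \<le> C0 \<and> (fst p = b \<or> V a (snd p) = C0) \<and>
      Pp a *v (D (fst p) *v \<Phi> k (fst p) (snd p)) = 0"
    unfolding \<beta>V by fastforce
  then obtain p where p: "\<And>k. fst (p k) \<in> {a..b} \<and> snd (p k) \<in> L \<and> V a (snd (p k)) \<le> C0 \<and>
      (fst (p k) = b \<or> V a (snd (p k)) = C0) \<and>
      Pp a *v (D (fst (p k)) *v \<Phi> k (fst (p k)) (snd (p k))) = 0"
    using choice by metis
  define \<tau> where "\<tau> k = fst (p k)" for k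
  define \<xi> where "\<xi> k = snd (p k)" for k
  have \<tau>: "\<tau> k \<in> {a..b}" and \<xi>L: "\<xi> k \<in> L" and \<xi>V: "V a (\<xi> k) \<le> C0"
    and alt: "\<tau> k = b \<or> V a (\<xi> k) = C0" for k
    using p by (auto simp: \<tau>_def \<xi>_def)
  have Uneg: "U (\<tau> k) (\<Phi> k (\<tau> k) (\<xi> k)) \<le> 0" for k
    using ker[of "D (\<tau> k) *v \<Phi> k (\<tau> k) (\<xi> k)"] D(3)[OF \<tau>[of k]] p[of k] by (simp add: \<tau>_def \<xi>_def)
  obtain R where R: "\<And>x. V a x \<le> C0 \<Longrightarrow> norm x \<le> R"
    using V_bounded_imp_bounded[of a a C0] by auto
  obtain K where K: "0 \<le> K" "\<And>t x. t \<in> {a..b} \<Longrightarrow> norm (cutoff C1 t x) \<le> K * (1 + norm x)"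
    using cutoff_growth[of a b C1] by blast
  obtain y r where r: "strict_mono (r :: nat \<Rightarrow> nat)" and ycont: "continuous_on {a..b} y"
    and conv: "\<And>e. 0 < e \<Longrightarrow> \<exists>N. \<forall>n t. n \<ge> N \<and> t \<in> {a..b} \<longrightarrow> norm (\<Phi> (r n) t (\<xi> (r n)) - y t) < e"
    and y: "\<And>t. t \<in> {a..b} \<Longrightarrow> (y has_vector_derivative cutoff C1 t (y t)) (at t within {a..b})"
    using euler_convergence[OF ab cont_cutoff K, of \<xi> R] R[OF \<xi>V] unfolding \<Phi>_def by metis
  \<comment> \<open>The zeros occur at times that vary with the step size, so these times need a
    convergent subsequence as well.\<close>
  have "\<exists>l\<in>{a..b}. \<exists>q. strict_mono q \<and> ((\<lambda>n. \<tau> (r n)) \<circ> q) \<longlonglongrightarrow> l"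
    using compact_Icc[of a b, unfolded compact_def, THEN spec, of "\<lambda>n. \<tau> (r n)"] \<tau> by simp
  then obtain t0 q where t0: "t0 \<in> {a..b}" and q: "strict_mono (q :: nat \<Rightarrow> nat)"
    and \<tau>lim: "(\<lambda>n. \<tau> (r (q n))) \<longlonglongrightarrow> t0" by (auto simp: o_def)
  have unif: "(\<lambda>n. \<Phi> (r (q n)) (s n) (\<xi> (r (q n))) - y (s n)) \<longlonglongrightarrow> 0"
    if s: "\<And>n. s n \<in> {a..b}" for s
    unfolding lim_sequentially
  proof (intro allI impI)
    fix e :: real assume "0 < e"
    then obtain N where N: "\<And>n t. n \<ge> N \<Longrightarrow> t \<in> {a..b} \<Longrightarrow> norm (\<Phi> (r n) t (\<xi> (r n)) - y t) < e"
      using conv by blast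
    have "dist (\<Phi> (r (q n)) (s n) (\<xi> (r (q n))) - y (s n)) 0 < e" if "N \<le> n" for n
      using N[of "q n" "s n"] s seq_suble[OF q, of n] that by (simp add: dist_norm)
    then show "\<exists>N. \<forall>n\<ge>N. dist (\<Phi> (r (q n)) (s n) (\<xi> (r (q n))) - y (s n)) 0 < e" by blast
  qed
  have \<xi>lim: "(\<lambda>n. \<xi> (r (q n))) \<longlonglongrightarrow> y a"
    using unif[of "\<lambda>_. a"] ab unfolding start\<Phi> by (simp add: LIM_zero_iff)
  have "(\<lambda>n. y (\<tau> (r (q n)))) \<longlonglongrightarrow> y t0"
    using ycont t0 \<tau> \<tau>lim unfolding continuous_on_sequentially by (auto simp: o_def)
  from tendsto_add[OF unif[of "\<lambda>n. \<tau> (r (q n))"] this] have \<Phi>lim: "(\<lambda>n. \<Phi> (r (q n)) (\<tau> (r (q n))) (\<xi> (r (q n)))) \<longlonglongrightarrow> y t0"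
    using \<tau> by simp
  have cU: "isCont (\<lambda>(t, x). U t x) z" and cV: "isCont (\<lambda>(t, x). V t x) z" for z
    using cont_U[of UNIV] cont_V[of UNIV] by (cases z, simp add: continuous_on_eq_continuous_at)+
  have Ulim: "(\<lambda>n. U (\<tau> (r (q n))) (\<Phi> (r (q n)) (\<tau> (r (q n))) (\<xi> (r (q n))))) \<longlonglongrightarrow> U t0 (y t0)"
    using isCont_tendsto_compose[OF cU tendsto_Pair[OF \<tau>lim \<Phi>lim]] by simp
  have Vlim: "(\<lambda>n. V a (\<xi> (r (q n)))) \<longlonglongrightarrow> V a (y a)"
    using isCont_tendsto_compose[OF cV tendsto_Pair[OF tendsto_const \<xi>lim]] by simp
  have U0: "U t0 (y t0) \<le> 0"
    by (rule LIMSEQ_le_const2[OF Ulim]) (use Uneg in blast)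
  have V0: "V a (y a) \<le> C0"
    by (rule LIMSEQ_le_const2[OF Vlim]) (use \<xi>V in blast)
  have yL: "y a \<in> L"
    using closed_sequentially[OF closed_subspace[OF L] _ \<xi>lim] \<xi>L by blast
  \<comment> \<open>Written as a vanishing product, the alternative \<open>\<tau> k = b\<close> or
    \<open>V a (\<xi> k) = C0\<close> is a closed condition and passes to the limit.\<close>
  have "(\<lambda>n. (\<tau> (r (q n)) - b) * (V a (\<xi> (r (q n))) - C0)) \<longlonglongrightarrow> (t0 - b) * (V a (y a) - C0)"
    by (intro tendsto_intros \<tau>lim Vlim)
  moreover have "(\<tau> (r (q n)) - b) * (V a (\<xi> (r (q n))) - C0) = 0" for n
    using alt[of "r (q n)"] by auto
  ultimately have "(t0 - b) * (V a (y a) - C0) = 0" by (simp add: LIMSEQ_const_iff)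
  \<comment> \<open>A solution starting on the boundary would still have \<open>U > 0\<close> at
    \<open>t0\<close>. What remains is \<open>t0 = b\<close>, so \<open>U \<le> 0\<close> holds at
    the right end.\<close>
  moreover have "V a (y a) \<noteq> C0"
  proof
    assume eq: "V a (y a) = C0"
    then have "y a \<noteq> 0" using C0(1) v0 unfolding V_def by (auto simp: sp_algebra[OF sp])
    then have "0 < U a (y a)" using decomp(2)[of a] yL unfolding pos_def_on_def L_def U_def by blast
    then show False using U_pos_from_boundary[OF C0 C1 ab y eq _ t0] U0 by simp
  qed
  ultimately have "U b (y b) \<le> 0" using U0 by simp
  from V_bound_interior[OF C0 C1 ab y V0 this] have V1: "V t (y t) \<le> C1" if "t \<in> {a..b}" for t
    using that by (simp add: less_imp_le)
  then have "(y has_vector_derivative f t (y t)) (at t within {a..b})" if "t \<in> {a..b}" for t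
    using y[OF that] cutoff_eq that by simp
  with V1 show ?thesis by blast
qed

text \<open>The possible values at time 0 of solutions on \<open>I k\<close> with
  \<open>V \<le> C1\<close> form nested nonempty compact sets \<open>K k\<close>; compactness is
  \<open>approx_sol_limit\<close> with zero lag. Uniqueness then glues the solutions through a
  common point into one on the whole line.\<close>

lemma bounded_solution_exists:
  "\<exists>x C. (\<forall>t. (x has_vector_derivative f t (x t)) (at t)) \<and> (\<forall>t. V t (x t) \<le> C)"
proof -
  obtain C0 where C0: "v0 < C0" "v0 * \<Lambda> < F C0" using F_unbounded[of v0] by blast
  obtain C1 where C1: "C0 < C1" "F C0 + v0 * \<Lambda> - l * C0 < F C1" using F_unbounded[of C0] by blast
  \<comment> \<open>The extra unit puts every \<open>t\<close> with
    \<open>\<bar>t\<bar> \<le> k\<close> into the interior, where derivatives within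
    \<open>I k\<close> are two-sided, and keeps \<open>I 0\<close> nondegenerate.\<close>
  define I where "I k = {- real k - 1..real k + 1}" for k
  define sol where "sol k y \<longleftrightarrow> (\<forall>t\<in>I k. (y has_vector_derivative f t (y t)) (at t within I k) \<and> V t (y t) \<le> C1)" for k y
  define K where "K k = {u. \<exists>y. sol k y \<and> y 0 = u}" for k
  have I0: "0 \<in> I k" for k by (simp add: I_def)
  have sub: "I k \<subseteq> I m" if "k \<le> m" for k m using that by (auto simp: I_def)
  have anti: "sol k y" if "sol m y" "k \<le> m" for k m y
    using that sub[OF that(2)] unfolding sol_def by (blast intro: has_vector_derivative_within_subset)
  have ne: "K k \<noteq> {}" for k
    using exists_on_interval[OF C0(1) less_imp_le[OF C0(2)] C1, of "- real k - 1" "real k + 1"]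
    unfolding K_def sol_def I_def by auto
  have comp: "compact (K k)" for k
  proof -
    obtain R where R: "\<And>t x. t \<in> I k \<Longrightarrow> V t x \<le> C1 \<Longrightarrow> norm x \<le> R"
      using V_bounded_imp_bounded[of "- real k - 1" "real k + 1" C1] unfolding I_def by blast
    have "norm p \<le> R" if "p \<in> K k" for p
      using that R I0 unfolding K_def sol_def by blast
    then have "bounded (K k)" by (rule boundedI)
    moreover have "closed (K k)"
      unfolding closed_sequential_limits
    proof (intro allI impI, elim conjE)
      fix p u assume pK: "\<forall>n. p n \<in> K k" and lim: "p \<longlonglongrightarrow> u"
      have "\<forall>n. \<exists>y. sol k y \<and> y 0 = p n" using pK unfolding K_def by blast
      then obtain z where z: "\<And>n. sol k (z n)" "\<And>n. z n 0 = p n" by metis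
      have ap: "approx_sol f (- real k - 1) (real k + 1) 0 (z n)" for n
        using z(1)[of n] unfolding sol_def I_def by (intro approx_sol_exact) auto
      obtain y r where r: "strict_mono (r :: nat \<Rightarrow> nat)"
        and conv: "\<And>e. 0 < e \<Longrightarrow> \<exists>N. \<forall>n t. n \<ge> N \<and> t \<in> I k \<longrightarrow> norm (z (r n) t - y t) < e"
        and y: "\<And>t. t \<in> I k \<Longrightarrow> (y has_vector_derivative f t (y t)) (at t within I k)"
      proof (rule approx_sol_limit[OF _ f(1), of "- real k - 1" "real k + 1" "\<lambda>_. 0" z R])
        show "approx_sol f (- real k - 1) (real k + 1) 0 (z n)" for n by (rule ap)
        show "norm (z n t) \<le> R" if "t \<in> {- real k - 1..real k + 1}" for n t
          using R[of t "z n t"] z(1)[of n] that unfolding sol_def I_def by blast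
        fix y and r :: "nat \<Rightarrow> nat"
        assume "strict_mono r" 
          "\<And>e. 0 < e \<Longrightarrow> \<exists>N. \<forall>n t. n \<ge> N \<and> t \<in> {- real k - 1..real k + 1} \<longrightarrow> norm (z (r n) t - y t) < e"
          "\<And>t. t \<in> {- real k - 1..real k + 1} \<Longrightarrow> (y has_vector_derivative f t (y t)) (at t within {- real k - 1..real k + 1})"
        then show thesis unfolding I_def[symmetric] by (rule that)
      qed auto
      have pw: "(\<lambda>n. z (r n) t) \<longlonglongrightarrow> y t" if "t \<in> I k" for t
        unfolding lim_sequentially dist_norm using conv that by meson
      have "V t (y t) \<le> C1" if t: "t \<in> I k" for t
      proof (rule LIMSEQ_le_const2)
        have "isCont (\<lambda>(t, x). V t x) (t, y t)"
          using cont_V[of UNIV] by (simp add: continuous_on_eq_continuous_at)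
        from isCont_tendsto_compose[OF this tendsto_Pair[OF tendsto_const pw[OF t]]]
        show "(\<lambda>n. V t (z (r n) t)) \<longlonglongrightarrow> V t (y t)" by simp
        show "\<exists>N. \<forall>n\<ge>N. V t (z (r n) t) \<le> C1" using z(1) t unfolding sol_def by blast
      qed
      then have "sol k y" using y by (simp add: sol_def)
      moreover have "y 0 = u"
        using LIMSEQ_subseq_LIMSEQ[OF lim r] by (intro LIMSEQ_unique[OF pw[OF I0]]) (simp add: z(2) o_def)
      ultimately show "u \<in> K k" unfolding K_def by blast
    qed
    ultimately show ?thesis by (simp add: compact_eq_bounded_closed)
  qed
  have "K m \<subseteq> K k" if "k \<le> m" for k m using anti that unfolding K_def by blast
  then have "\<Inter> (range K) \<noteq> {}" by (intro compact_nest comp ne)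
  then obtain p where "\<And>k. p \<in> K k" by blast
  then have "\<forall>k. \<exists>y. sol k y \<and> y 0 = p" unfolding K_def by blast
  then obtain y where y: "\<And>k. sol k (y k)" "\<And>k. y k 0 = p" by metis
  have same: "y k t = y m t" if "t \<in> I k" "k \<le> m" for k m t
  proof -
    have "is_interval (I k)" by (simp add: I_def is_interval_cc)
    moreover have "ode_solution_on f (I k) (y k)" "ode_solution_on f (I k) (y m)"
      using y(1)[of k] anti[OF y(1)[of m] that(2)] unfolding sol_def ode_solution_on_def by blast+
    ultimately show ?thesis
      using f(2) I0[of k] y(2) that(1) unfolding ode_uniqueness_def by metis
  qed
  define x where "x t = y (nat \<lceil>\<bar>t\<bar>\<rceil>) t" for t
  have x: "x t = y k t" if "t \<in> I k" for k t
  proof -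
    have "\<bar>t\<bar> \<le> real m" if "m = nat \<lceil>\<bar>t\<bar>\<rceil>" for m using that by linarith
    then have "t \<in> I m" if "m = nat \<lceil>\<bar>t\<bar>\<rceil>" for m
      using that by (simp only: I_def atLeastAtMost_iff) (smt (verit))
    then show ?thesis using same[of t k] same[of t _ k] that unfolding x_def by (metis nat_le_linear)
  qed
  have "(x has_vector_derivative f t (x t)) (at t) \<and> V t (x t) \<le> C1" for t
  proof -
    define k where "k = nat \<lceil>\<bar>t\<bar>\<rceil>"
    have tk: "\<bar>t\<bar> \<le> real k" unfolding k_def by linarith
    then have t: "t \<in> {- real k - 1<..<real k + 1}" by auto
    then have tI: "t \<in> I k" by (auto simp: I_def)
    have "(y k has_vector_derivative f t (y k t)) (at t within I k)" using y(1)[of k] tI by (simp add: sol_def)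
    then have "(y k has_vector_derivative f t (y k t)) (at t within {- real k - 1<..<real k + 1})"
      by (rule has_vector_derivative_within_subset) (auto simp: I_def)
    then have "(x has_vector_derivative f t (y k t)) (at t within {- real k - 1<..<real k + 1})"
      using t x[of _ k] by (rule has_vector_derivative_transform[rotated 2]) (auto simp: I_def)
    then have "(x has_vector_derivative f t (x t)) (at t)"
      unfolding has_vector_derivative_within_open[OF t open_greaterThanLessThan] x[OF tI] .
    moreover have "V t (x t) \<le> C1" using y(1)[of k] tI x[OF tI] by (simp add: sol_def)
    ultimately show ?thesis ..
  qed
  then show ?thesis by blast
qed

section \<open>Properties of an arbitrary bounded solution\<close>

context
  fixes x C
  assumes x: "\<And>t. (x has_vector_derivative f t (x t)) (at t)" and C: "\<And>t. V t (x t) \<le> C"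
begin

text \<open>The constant lower bound \<open>k\<close> of \<open>N\<close> on \<open>{v0..}\<close>
  makes \<open>U\<close> rise at least as fast as \<open>k * g\<close>.\<close>

lemma U_growth:
  assumes "a \<le> b" "\<And>t. t \<in> {a..b} \<Longrightarrow> v0 \<le> V t (x t)"
  shows "k * (g b - g a) \<le> U b (x b) - U a (x a)"
proof -
  have "(\<lambda>t. U t (x t) - k * g t) a \<le> (\<lambda>t. U t (x t) - k * g t) b"
  proof (rule has_real_derivative_mono[where u="\<lambda>t. U t (x t) - k * g t", OF assms(1)])
    fix t assume t: "t \<in> {a..b}"
    show "((\<lambda>t. U t (x t) - k * g t) has_real_derivative
        2 * sp (S t *v f t (x t)) (x t) + sp (S' t *v x t) (x t) - k * \<gamma> t) (at t within {a..b})"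
      by (intro DERIV_diff DERIV_cmult U_deriv has_vector_derivative_at_within[OF x]
          has_field_derivative_at_within[OF g(1)])
    have "k * \<gamma> t \<le> \<gamma> t * N (V t (x t))"
      using N(2)[OF assms(2)[OF t]] g(2)[of t] by (simp add: mult.commute mult_left_mono)
    also have "\<dots> \<le> 2 * sp (S t *v f t (x t)) (x t) + sp (S' t *v x t) (x t)"
      using rate_S[of t "x t"] assms(2)[OF t] by (simp add: V_def)
    finally show "0 \<le> 2 * sp (S t *v f t (x t)) (x t) + sp (S' t *v x t) (x t) - k * \<gamma> t" by simp
  qed
  then show ?thesis by (simp add: algebra_simps)
qed

lemma x_cont: "continuous_on I (\<lambda>t. V t (x t))"
  by (rule cont_along(2)[OF solution_cont[OF has_vector_derivative_at_within[OF x]]])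

text \<open>If \<open>V > v0\<close> held on a whole half-line, \<open>U\<close> would gain
  \<open>k\<close> times an unbounded increment of \<open>g\<close>, although boundedness of
  \<open>V\<close> confines \<open>U\<close> between \<open>l * C\<close> and
  \<open>\<Lambda> * C\<close>.\<close>

lemma eventually_low:
  shows "\<exists>b>t. V b (x b) \<le> v0" "\<exists>a<t. V a (x a) \<le> v0"
proof -
  have C0: "0 \<le> C" using C[of 0] V_nonneg[of 0] by (rule order.trans[rotated])
  have Uhi: "U s (x s) \<le> \<Lambda> * C" and Ulo: "l * C \<le> U s (x s)" for s
  proof -
    have "\<Lambda> * V s (x s) \<le> \<Lambda> * C" using \<Lambda>_pos C by simp
    then show "U s (x s) \<le> \<Lambda> * C" using U_le[of s "x s"] by linarith
    have "l * C \<le> l * V s (x s)" using l_neg C by simp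
    then show "l * C \<le> U s (x s)" using U_ge[of s "x s"] by linarith
  qed
  show "\<exists>b>t. V b (x b) \<le> v0"
  proof (rule ccontr)
    assume "\<not> ?thesis"
    then have gt: "v0 \<le> V s (x s)" if "t < s" for s using that by (meson le_cases)
    have le: "k * (g s - g (t + 1)) \<le> \<Lambda> * C - l * C" if "t + 1 \<le> s" for s
    proof -
      have "k * (g s - g (t + 1)) \<le> U s (x s) - U (t + 1) (x (t + 1))"
        by (intro U_growth that gt) auto
      then show ?thesis using Uhi[of s] Ulo[of "t + 1"] by linarith
    qed
    have "\<forall>\<^sub>F s in at_top. (\<Lambda> * C - l * C) / k + g (t + 1) < g s"
      using g(3) by (simp add: filterlim_at_top_dense)
    moreover have "\<forall>\<^sub>F s in at_top. t + 1 \<le> s" by (rule eventually_ge_at_top)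
    ultimately have "\<forall>\<^sub>F s::real in at_top. False"
    proof eventually_elim
      case (elim s)
      then have "(\<Lambda> * C - l * C) < (g s - g (t + 1)) * k" using N(1) by (simp add: field_simps)
      then show False using le[OF elim(2)] by (simp add: mult.commute)
    qed
    then show False by simp
  qed
  show "\<exists>a<t. V a (x a) \<le> v0"
  proof (rule ccontr)
    assume "\<not> ?thesis"
    then have gt: "v0 \<le> V s (x s)" if "s < t" for s using that by (meson le_cases)
    have le: "k * (g (t - 1) - g s) \<le> \<Lambda> * C - l * C" if "s \<le> t - 1" for s
    proof -
      have "k * (g (t - 1) - g s) \<le> U (t - 1) (x (t - 1)) - U s (x s)"
        by (intro U_growth that gt) auto
      then show ?thesis using Uhi[of "t - 1"] Ulo[of s] by linarith
    qed
    have "\<forall>\<^sub>F s in at_bot. g s < g (t - 1) - (\<Lambda> * C - l * C) / k"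
      using g(4) by (simp add: filterlim_at_bot_dense)
    moreover have "\<forall>\<^sub>F s in at_bot. s \<le> t - 1" by (rule eventually_le_at_bot)
    ultimately have "\<forall>\<^sub>F s::real in at_bot. False"
    proof eventually_elim
      case (elim s)
      then have "(\<Lambda> * C - l * C) < (g (t - 1) - g s) * k" using N(1) by (simp add: field_simps)
      then show False using le[OF elim(2)] by (simp add: mult.commute)
    qed
    then show False by simp
  qed
qed

text \<open>On the two sides of \<open>t\<close>, \<open>F(V)\<close> at \<open>t\<close> is at most
  \<open>U t - U a\<close> and at most \<open>U b - U t\<close>; adding cancels the value of
  \<open>U\<close> at \<open>t\<close> and produces the half. The excursion starts at
  \<open>a < t\<close> and ends at \<open>b > t\<close>, so only past values of \<open>llo\<close>
  and future values of \<open>lhi\<close> enter: hence the one-sided infimum and supremum in the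
  theorem.\<close>

lemma sharp_bound:
  assumes t: "v0 < V t (x t)"
  shows "\<exists>a<t. \<exists>b>t. F (V t (x t)) \<le> v0 / 2 * (lhi b - llo a)"
proof -
  obtain a' b' where a': "a' < t" "V a' (x a') \<le> v0" and b': "t < b'" "V b' (x b') \<le> v0"
    using eventually_low by metis
  obtain a where a: "a < t" "V a (x a) = v0" "\<And>s. s \<in> {a<..t} \<Longrightarrow> v0 < V s (x s)"
    using last_time_at_level[OF x_cont _ a'(2) t] a'(1) by force
  obtain b where b: "t < b" "V b (x b) = v0" "\<And>s. s \<in> {t..<b} \<Longrightarrow> v0 < V s (x s)"
    using first_time_at_level[OF x_cont _ t b'(2)] b'(1) by force
  have "F (V t (x t)) - F (V a (x a)) \<le> U t (x t) - U a (x a)"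
  proof (rule F_V_le_U(1)[OF has_vector_derivative_at_within[OF x]])
    show "v0 \<le> V s (x s)" if "s \<in> {a..t}" for s
      using a(2) a(3)[of s] that by (cases "s = a") auto
  qed (use a in auto)
  moreover have "F (V t (x t)) - F (V b (x b)) \<le> U b (x b) - U t (x t)"
  proof (rule F_V_le_U(2)[OF has_vector_derivative_at_within[OF x]])
    show "v0 \<le> V s (x s)" if "s \<in> {t..b}" for s
      using b(2) b(3)[of s] that by (cases "s = b") auto
  qed (use b in auto)
  moreover have "U b (x b) \<le> lhi b * v0" "llo a * v0 \<le> U a (x a)"
    using pencil(1)[of b "x b"] pencil(2)[of a "x a"] a(2) b(2) by (simp_all add: U_def V_def)
  ultimately have "F (V t (x t)) \<le> v0 / 2 * (lhi b - llo a)"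
    using a(2) b(2) F(1) by (simp add: algebra_simps)
  then show ?thesis using a(1) b(1) by blast
qed

end

end

section \<open>Uniqueness and the main theorem\<close>

text \<open>An open half-line as domain covers both \<open>\<gamma>\<close> and the integrand of
  \<open>F\<close>, whose continuity is known for positive arguments.\<close>

lemma oint_has_real_derivative:
  assumes cont: "continuous_on {a<..} h" and "a < c" "a < x"
  shows "((\<lambda>u. oint c u h) has_real_derivative h x) (at x)"
proof -
  define a' where "a' = (a + min c x) / 2"
  define b' where "b' = max c x + 1"
  have ab: "a < a'" "a' < c" "a' < x" "c < b'" "x < b'" using assms by (auto simp: a'_def b'_def)
  have "continuous_on {a'..b'} h" using ab by (intro continuous_on_subset[OF cont]) auto
  then have "((\<lambda>u. oint c u h) has_vector_derivative h x) (at x within {a'..b'})"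
    using ab by (intro interval_integral_FTC2) auto
  then show ?thesis
    using ab by (simp add: at_within_Icc_at has_real_derivative_iff_has_vector_derivative)
qed

lemma Liminf_less_one_imp_frequently:
  assumes "Liminf A (\<lambda>t. ereal (h t)) < 1"
  shows "\<exists>c<1. \<exists>\<^sub>F t in A. h t \<le> c"
proof -
  obtain y where y: "y < 1" "\<not> (\<forall>\<^sub>F t in A. y < ereal (h t))"
    using assms unfolding not_le[symmetric] le_Liminf_iff by blast
  \<comment> \<open>\<open>y\<close> is real: it is below \<open>1\<close>, and minus infinity lies
    below every \<open>ereal (h t)\<close>.\<close>
  obtain c where "y = ereal c" using y by (cases y) auto
  then show ?thesis
    using y by (intro exI[of _ c]) (auto simp: frequently_def not_le one_ereal_def)
qed

text \<open>Once \<open>W > 0\<close>, the logarithm of \<open>W\<close> grows at rate at least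
  \<open>q\<close> but stays below \<open>ln (lam t) + ln C\<close>, so
  \<open>oint 0 t q \<le> A + ln (lam t)\<close>. At the frequent times with
  \<open>ln (lam t) \<le> c * oint 0 t q\<close> this bounds \<open>(1 - c) * oint 0 t q\<close> by
  \<open>A\<close>, against divergence.\<close>

lemma exponential_growth_contradiction:
  fixes W W' q lam :: "real \<Rightarrow> real"
  assumes W: "\<And>t. (W has_real_derivative W' t) (at t)"
    and grow: "\<And>t. q t * \<bar>W t\<bar> \<le> W' t" and q: "\<And>t. 0 \<le> q t"
    and bound: "\<And>t. \<bar>W t\<bar> \<le> lam t * C"
    and Q: "filterlim (\<lambda>T. oint 0 T q) at_top at_top"
    and freq: "c < 1" "\<exists>\<^sub>F t in at_top. ln (lam t) / \<bar>oint 0 t q\<bar> \<le> c"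
    and lam: "\<And>t. 0 < lam t" and pos: "0 < W t0"
  shows False
proof -
  have mono: "W s \<le> W t" if "s \<le> t" for s t
  proof (rule DERIV_nonneg_imp_nondecreasing[OF that])
    have "0 \<le> W' x" for x using grow[of x] q[of x] by (meson abs_ge_zero mult_nonneg_nonneg order.trans)
    then show "\<exists>y. (W has_real_derivative y) (at x) \<and> 0 \<le> y" for x using W by blast
  qed
  define s where "s = max t0 0"
  have Wpos: "0 < W t" if "s \<le> t" for t using mono[of t0 t] that pos by (simp add: s_def)
  have Cpos: "0 < C"
    using bound[of s] Wpos[of s] lam[of s] by (simp add: zero_less_mult_iff) (smt (verit) mult_nonneg_nonpos)
  obtain T where T: "\<And>t. T \<le> t \<Longrightarrow> 0 < oint 0 t q"
    using Q unfolding filterlim_at_top_dense eventually_at_top_linorder by blast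
  define A where "A = integral {0..s} q + ln C - ln (W s)"
  have key: "oint 0 t q \<le> A + ln (lam t)" if t: "max s T \<le> t" for t
  proof -
    have t0: "0 \<le> s" "s \<le> t" using t by (auto simp: s_def)
    have eq: "oint 0 t q = (LINT x : {0..t} | lborel. q x)"
      using t0 interval_integral_Icc[of 0 t q] by simp
    \<comment> \<open>A function that is not integrable gets the default integral 0, so the positive
      value of the integral certifies integrability of \<open>q\<close> on
      \<open>{0..t}\<close>.\<close>
    then have "(LINT x : {0..t} | lborel. q x) \<noteq> 0" using T[of t] t by simp
    then have int: "set_integrable lborel {0..t} q"
      unfolding set_integrable_def set_lebesgue_integral_def using not_integrable_integral_eq by blast
    note I = set_borel_integral_eq_integral[OF int]
    have "integral {0..t} q = integral {0..s} q + integral {s..t} q"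
      using Henstock_Kurzweil_Integration.integral_combine[OF t0 I(1)] by simp
    moreover have "integral {s..t} q \<le> ln (W t) - ln (W s)"
    proof (rule has_integral_le)
      show "(q has_integral integral {s..t} q) {s..t}"
        using I(1) t0 by (intro integrable_integral integrable_subinterval_real[OF I(1)]) auto
      show "((\<lambda>x. W' x / W x) has_integral ln (W t) - ln (W s)) {s..t}"
      proof (rule fundamental_theorem_of_calculus[OF t0(2)])
        fix x assume "x \<in> {s..t}"
        then have "((\<lambda>x. ln (W x)) has_real_derivative (1 / W x) * W' x) (at x)"
          using Wpos by (intro DERIV_chain2[OF DERIV_ln_divide W]) auto
        then show "((\<lambda>x. ln (W x)) has_vector_derivative W' x / W x) (at x within {s..t})"
          by (simp add: has_real_derivative_iff_has_vector_derivative has_vector_derivative_at_within)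
      qed
      show "q x \<le> W' x / W x" if "x \<in> {s..t}" for x
        using grow[of x] Wpos[of x] that by (simp add: field_simps)
    qed
    moreover have "ln (W t) \<le> ln (lam t * C)"
      using bound[of t] Wpos[OF t0(2)] by simp
    moreover have "ln (lam t * C) = ln (lam t) + ln C" using lam Cpos by (rule ln_mult_pos)
    ultimately show ?thesis unfolding A_def using eq I(2) by linarith
  qed
  have "\<forall>\<^sub>F t in at_top. A / (1 - c) < oint 0 t q" using Q by (simp add: filterlim_at_top_dense)
  moreover have "\<forall>\<^sub>F t in at_top. max s T \<le> t" by (rule eventually_ge_at_top)
  ultimately have "\<forall>\<^sub>F t in at_top. \<not> ln (lam t) / \<bar>oint 0 t q\<bar> \<le> c"
  proof eventually_elim
    case (elim t)
    have Q0: "0 < oint 0 t q" using T elim(2) by simp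
    show ?case
    proof
      assume "ln (lam t) / \<bar>oint 0 t q\<bar> \<le> c"
      then have "ln (lam t) \<le> c * oint 0 t q" using Q0 by (simp add: field_simps)
      then have "(1 - c) * oint 0 t q \<le> A" using key[OF elim(2)] by (simp add: algebra_simps)
      then show False using elim(1) freq(1) by (simp add: field_simps)
    qed
  qed
  then show False using freq(2) by (simp add: frequently_def)
qed

lemma exponential_growth_imp_zero:
  fixes W W' q lam :: "real \<Rightarrow> real"
  assumes W: "\<And>t. (W has_real_derivative W' t) (at t)"
    and grow: "\<And>t. q t * \<bar>W t\<bar> \<le> W' t" and q: "\<And>t. 0 \<le> q t"
    and bound: "\<And>t. \<bar>W t\<bar> \<le> lam t * C" and lam: "\<And>t. 0 < lam t"
    and Q: "filterlim (\<lambda>T. oint 0 T q) at_top at_top" "filterlim (\<lambda>T. oint 0 T q) at_bot at_bot"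
    and L: "Liminf at_top (\<lambda>t. ereal (ln (lam t) / \<bar>oint 0 t q\<bar>)) < 1"
      "Liminf at_bot (\<lambda>t. ereal (ln (lam t) / \<bar>oint 0 t q\<bar>)) < 1"
  shows "W t = 0"
proof (rule ccontr)
  assume "W t \<noteq> 0"
  \<comment> \<open>A negative value is handled by reversing time: \<open>- W (- s)\<close>
    satisfies the same inequalities and is positive at \<open>s = - t\<close>.\<close>
  then consider "0 < W t" | "0 < - W (- (- t))" by force
  then show False
  proof cases
    case 1
    obtain c where "c < 1" "\<exists>\<^sub>F t in at_top. ln (lam t) / \<bar>oint 0 t q\<bar> \<le> c"
      using Liminf_less_one_imp_frequently[OF L(1)] by blast
    from exponential_growth_contradiction[OF W grow q bound Q(1) this lam 1] show False .
  next
    case 2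
    have refl: "oint 0 s (\<lambda>x. q (- x)) = - oint 0 (- s) q" for s
      using interval_integral_reflect[of 0 "ereal s" "\<lambda>x. q (- x)"]
        interval_integral_endpoints_reverse[of "ereal (- s)" 0 q]
      by (simp add: zero_ereal_def)
    obtain c where c: "c < 1" "\<exists>\<^sub>F t in at_bot. ln (lam t) / \<bar>oint 0 t q\<bar> \<le> c"
      using Liminf_less_one_imp_frequently[OF L(2)] by blast
    show False
    proof (rule exponential_growth_contradiction[where W="\<lambda>s. - W (- s)" and W'="\<lambda>s. W' (- s)"
          and q="\<lambda>s. q (- s)" and lam="\<lambda>s. lam (- s)" and C=C and c=c and ?t0.0="- t"])
      show "((\<lambda>s. - W (- s)) has_real_derivative W' (- s)) (at s)" for s
        using DERIV_minus[OF DERIV_chain2[OF W DERIV_minus[OF DERIV_ident]]] by simp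
      show "filterlim (\<lambda>T. oint 0 T (\<lambda>s. q (- s))) at_top at_top"
        using Q(2) unfolding refl by (simp add: filterlim_at_bot_mirror filterlim_uminus_at_bot)
      show "\<exists>\<^sub>F s in at_top. ln (lam (- s)) / \<bar>oint 0 s (\<lambda>s. q (- s))\<bar> \<le> c"
        using c(2) unfolding refl at_bot_mirror frequently_def eventually_filtermap by simp
    qed (use c(1) grow q bound lam 2 in auto)
  qed
qed

section \<open>Invertibility of \<open>F\<close> and uniqueness of the bounded solution\<close>

context guiding_pair
begin

lemma F_le_iff: "v0 \<le> u \<Longrightarrow> v0 \<le> v \<Longrightarrow> F u \<le> F v \<longleftrightarrow> u \<le> v"
  using F_mono[of u v] F_mono[of v u] by (cases u v rule: linorder_cases) auto

lemma F_bij: "bij_betw F {v0..} {0..}"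
  unfolding bij_betw_def
proof
  show "inj_on F {v0..}" proof (rule inj_onI)
    fix u v assume "u \<in> {v0..}" "v \<in> {v0..}" "F u = F v"
    then show "u = v" using F_le_iff[of u v] F_le_iff[of v u] by simp
  qed
  have "y \<in> F ` {v0..}" if "0 \<le> y" for y
  proof -
    obtain v where v: "v0 < v" "y < F v" using F_unbounded by blast
    have "continuous_on {v0..} F"
      unfolding continuous_on_eq_continuous_within by (intro ballI DERIV_continuous[OF F(2)]) simp
    then have "continuous_on {v0..v} F" by (rule continuous_on_subset) auto
    then show ?thesis using IVT'[of F v0 y v] v F(1) that by force
  qed
  then show "F ` {v0..} = {0..}" using F_nonneg by auto
qed

text \<open>For the difference \<open>y\<close> of two solutions, \<open>W = U t (y t)\<close>
  satisfies \<open>W' \<ge> (2 * \<gamma> + mu) * V \<ge> q * \<bar>W\<bar>\<close>, while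
  boundedness gives \<open>\<bar>W\<bar>\<close> at most a constant times \<open>la\<close>; hence
  \<open>W\<close> vanishes identically.\<close>

lemma bounded_solution_unique:
  fixes x z :: "real \<Rightarrow> real^'n" and mu la :: "real \<Rightarrow> real"
  defines "q \<equiv> (\<lambda>s. (2 * \<gamma> s + mu s) / la s)"
  assumes x: "\<And>t. (x has_vector_derivative f t (x t)) (at t)" "\<And>t. V t (x t) \<le> C"
    and z: "\<And>t. (z has_vector_derivative f t (z t)) (at t)" "\<And>t. V t (z t) \<le> C"
    and pos: "\<And>t. 0 < 2 * \<gamma> t + mu t"
    and mono: "\<And>t x y. \<gamma> t * V t y \<le> sp (S t *v (f t (x + y) - f t x)) y"
    and mu: "\<And>t y. mu t * V t y \<le> sp (S' t *v y) y"
    and la: "\<And>t. 0 < la t" "\<And>t y. \<bar>U t y\<bar> \<le> la t * V t y"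
    and Q: "filterlim (\<lambda>T. oint 0 T q) at_top at_top" "filterlim (\<lambda>T. oint 0 T q) at_bot at_bot"
    and L: "Liminf at_top (\<lambda>t. ereal (ln (la t) / \<bar>oint 0 t q\<bar>)) < 1"
      "Liminf at_bot (\<lambda>t. ereal (ln (la t) / \<bar>oint 0 t q\<bar>)) < 1"
  shows "x = z"
proof (rule ccontr)
  assume "x \<noteq> z"
  then obtain t1 where t1: "x t1 \<noteq> z t1" by blast
  define y where "y t = x t - z t" for t
  define W where "W t = U t (y t)" for t
  define W' where "W' t = 2 * sp (S t *v (f t (x t) - f t (z t))) (y t) + sp (S' t *v y t) (y t)" for t
  have W: "(W has_real_derivative W' t) (at t)" for t
  proof -
    have "(y has_vector_derivative f t (x t) - f t (z t)) (at t)"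
      unfolding y_def[abs_def] by (rule has_vector_derivative_diff[OF x(1) z(1)])
    from U_deriv[OF this] show ?thesis unfolding W_def[abs_def] W'_def .
  qed
  have W'ge: "(2 * \<gamma> t + mu t) * V t (y t) \<le> W' t" for t
    using mono[of t "y t" "z t"] mu[of t "y t"] unfolding W'_def y_def
    by (simp add: algebra_simps)
  have "W t = 0" for t
  proof (rule exponential_growth_imp_zero[OF W _ _ _ la(1) Q L])
    show "0 \<le> q t" for t using pos[of t] la(1)[of t] by (simp add: q_def)
    show "q t * \<bar>W t\<bar> \<le> W' t" for t
    proof -
      have "q t * \<bar>W t\<bar> \<le> q t * (la t * V t (y t))"
        unfolding W_def using la(2) \<open>0 \<le> q t\<close> by (rule mult_left_mono)
      also have "\<dots> = (2 * \<gamma> t + mu t) * V t (y t)" using la(1)[of t] by (simp add: q_def)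
      finally show ?thesis using W'ge[of t] by linarith
    qed
    show "\<bar>W t\<bar> \<le> la t * (4 * C)" for t
    proof -
      \<comment> \<open>The parallelogram law for \<open>V t\<close>; it is the source of the factor
        4.\<close>
      have "V t (x t + z t) + V t (x t - z t) = 2 * V t (x t) + 2 * V t (z t)"
        by (simp add: V_def sp_algebra[OF sp] matvec_algebra)
      then have "V t (y t) \<le> 4 * C"
        using V_nonneg[of t "x t + z t"] x(2)[of t] z(2)[of t] unfolding y_def by linarith
      then have "la t * V t (y t) \<le> la t * (4 * C)" using la(1)[of t] by simp
      then show ?thesis using la(2)[of t "y t"] unfolding W_def by linarith
    qed
  qed
  \<comment> \<open>That \<open>W\<close> vanishes does not give \<open>y = 0\<close>, since
    \<open>U\<close> may have nontrivial zeros. Its derivative does: it also vanishes, yet dominates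
    a positive multiple of \<open>V\<close>.\<close>
  then have "W = (\<lambda>_. 0)" by blast
  then have "W' t1 = 0" using DERIV_unique[OF W[of t1]] by (metis DERIV_const)
  moreover have "0 < V t1 (y t1)"
    using B(3)[of t1] t1 unfolding V_def pos_def_on_def y_def by simp
  then have "0 < (2 * \<gamma> t1 + mu t1) * V t1 (y t1)" using pos[of t1] by simp
  ultimately show False using W'ge[of t1] by linarith
qed

end

text \<open>\<open>V\<close> may rise or fall along a solution, so the contribution of the
  derivative of \<open>B\<close> is needed in modulus; this is the role of \<open>M\<close>.\<close>

lemma symmetric_pencil_char:
  assumes "is_scalar_product sp" "symmetric_op sp A" "symmetric_op sp B" "pos_def_on sp UNIV B"
  shows "\<bar>sp (A *v y) y\<bar> \<le> max \<bar>max_char A B\<bar> \<bar>min_char A B\<bar> * sp (B *v y) y"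
proof -
  have "0 \<le> sp (B *v y) y"
    using assms(4) unfolding pos_def_on_def by (cases "y = 0") (auto simp: sp_algebra[OF assms(1)] less_imp_le)
  then have "max_char A B * sp (B *v y) y \<le> max \<bar>max_char A B\<bar> \<bar>min_char A B\<bar> * sp (B *v y) y"
    "- max \<bar>max_char A B\<bar> \<bar>min_char A B\<bar> * sp (B *v y) y \<le> min_char A B * sp (B *v y) y"
    by (intro mult_right_mono; auto)+
  then show ?thesis using char_bounds[OF assms, of y] by linarith
qed

section \<open>From conditions (d)-(g) to the abstract setting and the two conclusions\<close>

theorem theorem4:
  fixes sp :: "real^'n \<Rightarrow> real^'n \<Rightarrow> real"
    and S B :: "real \<Rightarrow> real^'n^'n"
    and Pp Pm :: "real \<Rightarrow> real^'n^'n"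
    and Lp Lm :: "real \<Rightarrow> (real^'n) set"
    and f :: "real \<Rightarrow> real^'n \<Rightarrow> real^'n"
    and \<gamma> \<Gamma> \<Delta> :: "real \<Rightarrow> real"
    and v\<^sub>0 :: real
  defines "lam_max \<equiv> (\<lambda>t. max_char (S t) (B t))"
    and "lam_min \<equiv> (\<lambda>t. min_char (S t) (B t))"
    and "lam_min_plus \<equiv> (\<lambda>t. Min (char_values_on (Pp t) (Lp t) (S t) (B t)))"
    and "M \<equiv> (\<lambda>t. max \<bar>max_char (vector_derivative B (at t)) (B t)\<bar>
                      \<bar>min_char (vector_derivative B (at t)) (B t)\<bar>)"
    and "mu_min \<equiv> (\<lambda>t. min_char (vector_derivative S (at t)) (B t))"
  defines "\<xi> \<equiv> (INF t. mu_min t / \<gamma> t)"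
    and "\<sigma> \<equiv> (SUP t. M t / \<gamma> t)"
  defines "F \<equiv> (\<lambda>v. oint v\<^sub>0 v (\<lambda>u. (2 * \<Gamma> u + \<xi> * u) / (2 * \<Delta> u + \<sigma> * u)))"
  defines "lam_abs \<equiv> (\<lambda>t. max (lam_max t) \<bar>lam_min t\<bar>)"
  defines "q \<equiv> (\<lambda>s. (2 * \<gamma> s + mu_min s) / lam_abs s)"
  assumes sp: "is_scalar_product sp"
    and S: "S C1_differentiable_on UNIV" "\<And>t. invertible (S t)" "\<And>t. symmetric_op sp (S t)"
      "\<And>t. nondegenerate_form sp (S t)" "\<And>t. indefinite_form sp (S t)"
    and B: "B C1_differentiable_on UNIV" "\<And>t. invertible (B t)" "\<And>t. symmetric_op sp (B t)"
    and f: "continuous_on UNIV (\<lambda>(t, x). f t x)" "ode_uniqueness f"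
    and d: "\<And>t. pos_def_on sp UNIV (B t)"
      "\<And>t. direct_sum_projectors (Pp t) (Pm t) (Lp t) (Lm t)"
      "\<And>t. invariant_subspace (S t) (Lp t)" "\<And>t. invariant_subspace (S t) (Lm t)"
      "\<And>t. pos_def_on sp (Lp t) (S t)" "\<And>t. neg_def_on sp (Lm t) (S t)"
    and e: "continuous_on UNIV \<gamma>" "\<And>t. 0 < \<gamma> t"
      "continuous_on {0<..} \<Gamma>" "continuous_on {0<..} \<Delta>" "\<And>v. 0 < v \<Longrightarrow> 0 < \<Delta> v"
      "\<And>t v x. 0 < v \<Longrightarrow> sp (B t *v x) x = v \<Longrightarrow> \<gamma> t * \<Gamma> v \<le> sp (S t *v f t x) x"
      "\<And>t v x. 0 < v \<Longrightarrow> sp (B t *v x) x = v \<Longrightarrow> \<bar>sp (B t *v f t x) x\<bar> \<le> \<gamma> t * \<Delta> v"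
      "filterlim (\<lambda>T. oint T 0 \<gamma>) at_top at_bot" "filterlim (\<lambda>T. oint 0 T \<gamma>) at_top at_top"
    and f_bounds: "bdd_above (range lam_max)" "bdd_below (range lam_min)"
      "0 < Limsup at_bot (\<lambda>t. ereal (lam_min_plus t))"
      "bdd_below (range (\<lambda>t. mu_min t / \<gamma> t))" "bdd_above (range (\<lambda>t. M t / \<gamma> t))"
    and g: "0 < v\<^sub>0" "0 < 2 * \<Gamma> v\<^sub>0 + \<xi> * v\<^sub>0"
      "\<And>v. v\<^sub>0 < v \<Longrightarrow> - \<xi> / 2 \<le> (\<Gamma> v - \<Gamma> v\<^sub>0) / (v - v\<^sub>0)"
      "filterlim F at_top at_top"
  shows "bij_betw F {v\<^sub>0..} {0..} \<and>
    (\<exists>v_star x_star.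
       v\<^sub>0 \<le> v_star \<and> F v_star = v\<^sub>0 / 2 * ((SUP t. lam_max t) - (INF t. lam_min t)) \<and>
       ode_solution_on f UNIV x_star \<and>
       (\<forall>t. let w = the_inv_into {v\<^sub>0..} F
                      (v\<^sub>0 / 2 * ((SUP s\<in>{t..}. lam_max s) - (INF s\<in>{..t}. lam_min s)))
            in sp (B t *v x_star t) (x_star t) \<le> w \<and> w \<le> v_star) \<and>
       ((\<forall>t. 0 < 2 * \<gamma> t + mu_min t) \<and>
        (\<forall>t x y. \<gamma> t * sp (B t *v y) y \<le> sp (S t *v (f t (x + y) - f t x)) y) \<and>
        filterlim (\<lambda>T. oint 0 T q) at_top at_top \<and> filterlim (\<lambda>T. oint 0 T q) at_bot at_bot \<and>
        Liminf at_top (\<lambda>t. ereal (ln (lam_abs t) / \<bar>oint 0 t q\<bar>)) < 1 \<and>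
        Liminf at_bot (\<lambda>t. ereal (ln (lam_abs t) / \<bar>oint 0 t q\<bar>)) < 1
        \<longrightarrow> (\<forall>x. ode_solution_on f UNIV x \<and> bdd_above (range (\<lambda>t. sp (B t *v x t) (x t)))
                  \<longleftrightarrow> x = x_star)))"
proof -
  define S' where "S' t = vector_derivative S (at t)" for t
  define B' where "B' t = vector_derivative B (at t)" for t
  define V where "V t x = sp (B t *v x) x" for t x
  define \<Lambda> where "\<Lambda> = (SUP t. lam_max t)"
  define l where "l = (INF t. lam_min t)"
  have S': "(S has_vector_derivative S' t) (at t)" and S'_cont: "continuous_on UNIV S'" for t
  proof -
    obtain D where D: "\<And>t. (S has_vector_derivative D t) (at t)" "continuous_on UNIV D"
      using S(1) unfolding C1_differentiable_on_def by blast
    moreover have "S' = D" unfolding S'_def using D(1) vector_derivative_at by blast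
    ultimately show "(S has_vector_derivative S' t) (at t)" "continuous_on UNIV S'" by auto
  qed
  have B': "(B has_vector_derivative B' t) (at t)" for t
    using B(1) vector_derivative_at unfolding C1_differentiable_on_def B'_def by (metis UNIV_I)
  have Vpos: "0 < V t x" if "x \<noteq> 0" for t x using d(1)[of t] that by (simp add: V_def pos_def_on_def)
  have S'sym: "symmetric_op sp (S' t)" and B'sym: "symmetric_op sp (B' t)" for t
    using symmetric_op_derivative[OF sp S(3) S'] symmetric_op_derivative[OF sp B(3) B'] by auto
  have pen: "lam_min t * V t x \<le> sp (S t *v x) x" "sp (S t *v x) x \<le> lam_max t * V t x" for t x
    unfolding lam_min_def lam_max_def V_def by (rule char_bounds[OF sp S(3) B(3) d(1)])+
  have mu: "mu_min t * V t x \<le> sp (S' t *v x) x" for t x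
    unfolding mu_min_def V_def S'_def[symmetric] by (rule char_bounds[OF sp S'sym B(3) d(1)])
  have M: "\<bar>sp (B' t *v x) x\<bar> \<le> M t * V t x" for t x
    unfolding M_def V_def B'_def[symmetric] by (rule symmetric_pencil_char[OF sp B'sym B(3) d(1)])
  \<comment> \<open>An indefinite form takes both signs, which forces the extreme characteristic
    values to have opposite signs.\<close>
  have lam: "0 < lam_max t" "lam_min t < 0" for t
  proof -
    obtain x y where xy: "0 < sp (S t *v x) x" "sp (S t *v y) y < 0"
      using S(5)[of t] unfolding indefinite_form_def by blast
    then have "x \<noteq> 0" "y \<noteq> 0" by (auto simp: sp_algebra[OF sp])
    then show "0 < lam_max t" "lam_min t < 0"
      using pen(2)[of t x] pen(1)[of t y] xy Vpos[of x t] Vpos[of y t]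
      by (smt (verit) mult_nonpos_nonneg mult_nonneg_nonneg)+
  qed
  have \<xi>: "\<xi> * \<gamma> t \<le> mu_min t" for t
  proof -
    have "\<xi> \<le> mu_min t / \<gamma> t" unfolding \<xi>_def by (rule cINF_lower[OF f_bounds(4)]) simp
    then show ?thesis using e(2)[of t] by (simp add: field_simps)
  qed
  \<comment> \<open>\<open>\<sigma>\<close> is nonnegative because \<open>M\<close> is a maximum of
    moduli; together with \<open>\<Delta> > 0\<close> this keeps the denominator in \<open>F\<close>
    positive.\<close>
  have \<sigma>: "M t \<le> \<sigma> * \<gamma> t" and \<sigma>0: "0 \<le> \<sigma>" for t
  proof -
    have *: "M t / \<gamma> t \<le> \<sigma>" for t unfolding \<sigma>_def by (rule cSUP_upper[OF _ f_bounds(5)]) simp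
    show "M t \<le> \<sigma> * \<gamma> t" using *[of t] e(2)[of t] by (simp add: field_simps)
    have "0 \<le> M 0 / \<gamma> 0" using e(2)[of 0] unfolding M_def by (intro divide_nonneg_pos) auto
    then show "0 \<le> \<sigma>" using *[of 0] by linarith
  qed
  \<comment> \<open>The difference-quotient condition in (g) says that
    \<open>2 * \<Gamma> v + \<xi> * v\<close> is smallest on \<open>{v\<^sub>0..}\<close> at
    \<open>v\<^sub>0\<close>; its positive value there is the constant \<open>k\<close> of the
    locale.\<close>
  have N: "2 * \<Gamma> v\<^sub>0 + \<xi> * v\<^sub>0 \<le> 2 * \<Gamma> v + \<xi> * v" if "v\<^sub>0 \<le> v" for v
  proof (cases "v = v\<^sub>0")
    case False
    then show ?thesis using g(3)[of v] that by (simp add: field_simps)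
  qed simp
  have E: "0 < 2 * \<Delta> v + \<sigma> * v" if "0 < v" for v
    using e(5)[OF that] \<sigma>0 that by (simp add: add_pos_nonneg)
  interpret guiding_pair sp S B S' B' Pp Pm Lp Lm f \<gamma> "\<lambda>T. oint 0 T \<gamma>"
    "\<lambda>v. 2 * \<Gamma> v + \<xi> * v" "\<lambda>v. 2 * \<Delta> v + \<sigma> * v" F lam_max lam_min v\<^sub>0 \<Lambda> l
    "2 * \<Gamma> v\<^sub>0 + \<xi> * v\<^sub>0"
    rewrites "guiding_pair.V sp B = V"
  proof -
    show gp: "guiding_pair sp S B S' B' Pp Pm Lp Lm f \<gamma> (\<lambda>T. oint 0 T \<gamma>)
      (\<lambda>v. 2 * \<Gamma> v + \<xi> * v) (\<lambda>v. 2 * \<Delta> v + \<sigma> * v) F lam_max lam_min v\<^sub>0 \<Lambda> l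
      (2 * \<Gamma> v\<^sub>0 + \<xi> * v\<^sub>0)"
    proof unfold_locales
      show "((\<lambda>T. oint 0 T \<gamma>) has_real_derivative \<gamma> t) (at t)" for t
        by (rule oint_has_real_derivative[where a="min 0 t - 1"])
          (auto intro: continuous_on_subset[OF e(1)])
      have "(\<lambda>T. oint 0 T \<gamma>) = (\<lambda>T. - oint T 0 \<gamma>)"
        using interval_integral_endpoints_reverse[of "ereal 0"] by blast
      then show "filterlim (\<lambda>T. oint 0 T \<gamma>) at_bot at_bot"
        using e(8) by (simp add: filterlim_uminus_at_top)
      show "\<gamma> t * (2 * \<Gamma> (sp (B t *v x) x) + \<xi> * sp (B t *v x) x)
          \<le> 2 * sp (S t *v f t x) x + sp (S' t *v x) x"
        if "v\<^sub>0 \<le> sp (B t *v x) x" for t x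
      proof -
        have v: "0 < sp (B t *v x) x" using that g(1) by linarith
        have "\<xi> * \<gamma> t * V t x \<le> mu_min t * V t x"
          using v unfolding V_def by (intro mult_right_mono \<xi>) auto
        then show ?thesis
          using e(6)[OF v refl] mu[of t x] unfolding V_def by (simp add: algebra_simps)
      qed
      show "\<bar>2 * sp (B t *v f t x) x + sp (B' t *v x) x\<bar>
          \<le> \<gamma> t * (2 * \<Delta> (sp (B t *v x) x) + \<sigma> * sp (B t *v x) x)"
        if "v\<^sub>0 \<le> sp (B t *v x) x" for t x
      proof -
        have v: "0 < sp (B t *v x) x" using that g(1) by linarith
        have "M t * V t x \<le> \<sigma> * \<gamma> t * V t x"
          using v unfolding V_def by (intro mult_right_mono \<sigma>) auto
        moreover have "\<gamma> t * (2 * \<Delta> (V t x) + \<sigma> * V t x) = 2 * (\<gamma> t * \<Delta> (V t x)) + \<sigma> * \<gamma> t * V t x"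
          by (simp add: algebra_simps)
        ultimately show ?thesis
          using e(7)[OF v refl] M[of t x] unfolding V_def by linarith
      qed
      show "F v\<^sub>0 = 0" by (simp add: F_def)
      show "(F has_real_derivative (2 * \<Gamma> v + \<xi> * v) / (2 * \<Delta> v + \<sigma> * v)) (at v within {v\<^sub>0..})"
        if "v\<^sub>0 \<le> v" for v
        unfolding F_def
      proof (rule has_field_derivative_at_within, rule oint_has_real_derivative[where a=0])
        show "continuous_on {0<..} (\<lambda>u. (2 * \<Gamma> u + \<xi> * u) / (2 * \<Delta> u + \<sigma> * u))"
          using E by (intro continuous_intros e(3,4)) force
      qed (use that g(1) in auto)
      show "lam_max t \<le> \<Lambda>" for t unfolding \<Lambda>_def by (rule cSUP_upper[OF _ f_bounds(1)]) simp
      show "l \<le> lam_min t" for t unfolding l_def by (rule cINF_lower[OF f_bounds(2)]) simp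
    qed (use sp S' S'_cont S B' B f d e g N E pen lam in \<open>simp_all add: V_def\<close>)
    show "guiding_pair.V sp B = V" by (intro ext) (simp add: guiding_pair.V_def[OF gp] V_def)
  qed
  obtain x_star C where x: "\<And>t. (x_star has_vector_derivative f t (x_star t)) (at t)"
    and C: "\<And>t. V t (x_star t) \<le> C"
    using bounded_solution_exists by blast
  define F_inv where "F_inv = the_inv_into {v\<^sub>0..} F"
  have F_inv: "v\<^sub>0 \<le> F_inv y" "F (F_inv y) = y" if "0 \<le> y" for y
    using that F_bij f_the_inv_into_f_bij_betw[OF F_bij] the_inv_into_into[of F "{v\<^sub>0..}" y "{v\<^sub>0..}"]
    unfolding F_inv_def bij_betw_def by auto
  define hi where "hi t = (SUP s\<in>{t..}. lam_max s)" for t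
  define lo where "lo t = (INF s\<in>{..t}. lam_min s)" for t
  have hi: "lam_max s \<le> hi t" if "t \<le> s" for s t
    unfolding hi_def by (rule cSUP_upper) (use that f_bounds(1) in \<open>auto intro: bdd_above_mono\<close>)
  have lo: "lo t \<le> lam_min s" if "s \<le> t" for s t
    unfolding lo_def by (rule cINF_lower) (use that f_bounds(2) in \<open>auto intro: bdd_below_mono\<close>)
  have hi\<Lambda>: "hi t \<le> \<Lambda>" for t
    unfolding hi_def by (rule cSUP_least) (use pencil(5) in auto)
  have lol: "l \<le> lo t" for t
    unfolding lo_def by (rule cINF_greatest) (use pencil(6) in auto)
  \<comment> \<open>Both extrema range over sets containing \<open>t\<close>, so
    \<open>lo t \<le> lam_min t < 0 < lam_max t \<le> hi t\<close>.\<close>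
  have nn: "0 \<le> v\<^sub>0 / 2 * (hi t - lo t)" for t
    using hi[of t t] lo[of t t] lam[of t] v0 by (intro mult_nonneg_nonneg) auto
  define v_star where "v_star = F_inv (v\<^sub>0 / 2 * (\<Lambda> - l))"
  have "0 \<le> v\<^sub>0 / 2 * (\<Lambda> - l)" using \<Lambda>_pos l_neg v0 by (intro mult_nonneg_nonneg) auto
  note v_star = F_inv[OF this, folded v_star_def]
  have w: "F_inv (v\<^sub>0 / 2 * (hi t - lo t)) \<le> v_star" for t
  proof -
    have "v\<^sub>0 / 2 * (hi t - lo t) \<le> v\<^sub>0 / 2 * (\<Lambda> - l)"
      using hi\<Lambda>[of t] lol[of t] v0 by (intro mult_left_mono) auto
    then show ?thesis using F_le_iff[OF F_inv(1)[OF nn] v_star(1)] F_inv(2)[OF nn] v_star(2) by simp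
  qed
  have bd: "V t (x_star t) \<le> F_inv (v\<^sub>0 / 2 * (hi t - lo t))" for t
  \<comment> \<open>Up to the level \<open>v\<^sub>0\<close> there is nothing to show, because
    \<open>F_inv\<close> takes values in \<open>{v\<^sub>0..}\<close>; above it,
    \<open>sharp_bound\<close> applies.\<close>
  proof (cases "V t (x_star t) \<le> v\<^sub>0")
    case True
    then show ?thesis using F_inv(1)[OF nn] by (rule order.trans)
  next
    case False
    then obtain a b where ab: "a < t" "t < b"
      "F (V t (x_star t)) \<le> v\<^sub>0 / 2 * (lam_max b - lam_min a)"
      using sharp_bound[OF x C] by (meson not_le)
    have "v\<^sub>0 / 2 * (lam_max b - lam_min a) \<le> v\<^sub>0 / 2 * (hi t - lo t)"
      using hi[of t b] lo[of a t] ab(1,2) v0 by (intro mult_left_mono) auto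
    then have "F (V t (x_star t)) \<le> F (F_inv (v\<^sub>0 / 2 * (hi t - lo t)))"
      unfolding F_inv(2)[OF nn] using ab(3) by linarith
    then show ?thesis using F_le_iff[OF _ F_inv(1)[OF nn]] False by simp
  qed
  have unique: "(\<forall>x. ode_solution_on f UNIV x \<and> bdd_above (range (\<lambda>t. V t (x t))) \<longleftrightarrow> x = x_star)"
    if pos: "\<forall>t. 0 < 2 * \<gamma> t + mu_min t"
      and mono: "\<forall>t x y. \<gamma> t * V t y \<le> sp (S t *v (f t (x + y) - f t x)) y"
      and Q: "filterlim (\<lambda>T. oint 0 T q) at_top at_top" "filterlim (\<lambda>T. oint 0 T q) at_bot at_bot"
      and L: "Liminf at_top (\<lambda>t. ereal (ln (lam_abs t) / \<bar>oint 0 t q\<bar>)) < 1"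
        "Liminf at_bot (\<lambda>t. ereal (ln (lam_abs t) / \<bar>oint 0 t q\<bar>)) < 1"
  proof (intro allI iffI)
    fix z assume z: "ode_solution_on f UNIV z \<and> bdd_above (range (\<lambda>t. V t (z t)))"
    then obtain C' where C': "\<And>t. V t (z t) \<le> C'" unfolding bdd_above_def by auto
    show "z = x_star"
    proof (rule bounded_solution_unique[where C="max C C'" and mu=mu_min and la=lam_abs])
      show "\<bar>U t y\<bar> \<le> lam_abs t * V t y" for t y
      proof -
        have "0 \<le> V t y" by (rule V_nonneg)
        then have "lam_max t * V t y \<le> lam_abs t * V t y" "- lam_abs t * V t y \<le> lam_min t * V t y"
          unfolding lam_abs_def by (intro mult_right_mono; auto)+
        then show ?thesis using pen[of t y] unfolding U_def by linarith
      qed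
      show "0 < lam_abs t" for t using lam(1)[of t] by (simp add: lam_abs_def)
      show "(z has_vector_derivative f t (z t)) (at t)" for t
        using z by (simp add: ode_solution_on_def)
      show "V t (z t) \<le> max C C'" "V t (x_star t) \<le> max C C'" for t
        using C[of t] C'[of t] by auto
    qed (use x pos mono mu Q L in \<open>simp_all add: q_def\<close>)
  next
    fix z assume "z = x_star"
    then show "ode_solution_on f UNIV z \<and> bdd_above (range (\<lambda>t. V t (z t)))"
      using x C by (auto simp: ode_solution_on_def bdd_above_def)
  qed
  have "ode_solution_on f UNIV x_star" using x by (simp add: ode_solution_on_def)
  moreover have "\<forall>t. V t (x_star t) \<le> F_inv (v\<^sub>0 / 2 * (hi t - lo t)) \<and>
      F_inv (v\<^sub>0 / 2 * (hi t - lo t)) \<le> v_star"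
    using bd w by blast
  ultimately show ?thesis
    using F_bij v_star unique
    unfolding V_def \<Lambda>_def l_def hi_def lo_def F_inv_def Let_def
    by (intro conjI exI[of _ v_star] exI[of _ x_star] impI) (assumption | elim conjE, assumption | blast)+
qed

end
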